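(* Let $s,t$ be integers with $s,t>1$ and $\gcd(s,t)=1$, and let $\nu(s,t)$ be the number of distinct complex values taken by $\mathrm{GBG\text{-}rank}(\pi,s)$ as $\pi$ ranges over all $t$-cores. Then \[ \nu(s,t)=\frac{1}{t+s}\binom{t+s}{t} \] if and only if either $s$ is prime, or $s$ is composite and $t<2p_s$, where $p_s$ is the smallest prime divisor of $s$.
   Context: Let $\omega_s=e^{2\pi I/s}$, $I=\sqrt{-1}$. For a partition $\pi$ with Young diagram cells $(i,j)$ (row $i$, column $j$), and $0\le k\le s-1$, $r_k(\pi,s)$ is the number of cells with $j-i\equiv k\pmod s$; $\mathrm{GBG\text{-}rank}(\pi,s)=\sum_{k=0}^{s-1} r_k(\pi,s)\omega_s^k$. A rim hook of $\pi$ is a connected collection of rim cells (cells sharing a vertex or edge with the boundary of the diagram) whose removal leaves the diagram of a partition; $\pi$ is a $t$-core if it has no rim hook of length $t$. *)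

theory Defs
  imports Complex_Main "HOL-Number_Theory.Number_Theory"
begin

definition is_partition :: "nat list \<Rightarrow> bool" where
  "is_partition \<pi> \<longleftrightarrow> sorted_wrt (\<ge>) \<pi> \<and> (\<forall>p \<in> set \<pi>. p > 0)"

text \<open>Rows and columns are numbered from 0; only the difference of column and row matters below.\<close>

definition diagram :: "nat list \<Rightarrow> (nat \<times> nat) set" where
  "diagram \<pi> = {(i, j). i < length \<pi> \<and> j < \<pi> ! i}"

definition residue_count :: "nat list \<Rightarrow> nat \<Rightarrow> nat \<Rightarrow> nat" where
  "residue_count \<pi> s k = card {(i, j). (i, j) \<in> diagram \<pi> \<and> [int j - int i = int k] (mod int s)}"

definition omega :: "nat \<Rightarrow> complex" where
  "omega s = exp (2 * of_real pi * \<i> / of_nat s)"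

definition GBG_rank :: "nat list \<Rightarrow> nat \<Rightarrow> complex" where
  "GBG_rank \<pi> s = (\<Sum>k = 0..s - 1. of_nat (residue_count \<pi> s k) * omega s ^ k)"

text \<open>
  Geometrically, the cell (i, j) is the unit square whose corners are the lattice points below,
  the point (i, j) being its upper left corner.
\<close>

definition corners :: "nat \<times> nat \<Rightarrow> (nat \<times> nat) set" where
  "corners c = {fst c, Suc (fst c)} \<times> {snd c, Suc (snd c)}"

text \<open>
  As usual for rims, the boundary is the lower right one, i.e. the lattice path from the lower left
  to the upper right end of the diagram, without its straight left and top sides. A lattice point
  lies on this path iff it is a corner of a cell of the diagram and the square to its lower right
  is not in the diagram.
\<close>

definition boundary_points :: "(nat \<times> nat) set \<Rightarrow> (nat \<times> nat) set" where
  "boundary_points D = {q. q \<notin> D \<and> (\<exists>c \<in> D. q \<in> corners c)}"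

text \<open>A cell that shares an edge with the boundary also shares a vertex with it.\<close>

definition rim :: "(nat \<times> nat) set \<Rightarrow> (nat \<times> nat) set" where
  "rim D = {c \<in> D. corners c \<inter> boundary_points D \<noteq> {}}"

lemma diagram_down_closed:
  assumes "is_partition \<pi>" "(i, j) \<in> diagram \<pi>" "i' \<le> i" "j' \<le> j"
  shows "(i', j') \<in> diagram \<pi>"
proof -
  have "\<pi> ! i \<le> \<pi> ! i'"
    using assms sorted_wrt_nth_less[of "(\<ge>)" \<pi> i' i]
    by (cases "i' = i") (auto simp: is_partition_def diagram_def)
  then show ?thesis using assms by (auto simp: diagram_def)
qed

lemma mem_rim_diagram_iff:
  assumes "is_partition \<pi>"
  shows "(i, j) \<in> rim (diagram \<pi>) \<longleftrightarrow> (i, j) \<in> diagram \<pi> \<and> (Suc i, Suc j) \<notin> diagram \<pi>"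
proof
  assume "(i, j) \<in> rim (diagram \<pi>)"
  then obtain a b where "(i, j) \<in> diagram \<pi>" "(a, b) \<notin> diagram \<pi>" "a \<le> Suc i" "b \<le> Suc j"
    by (auto simp: rim_def boundary_points_def corners_def)
  then show "(i, j) \<in> diagram \<pi> \<and> (Suc i, Suc j) \<notin> diagram \<pi>"
    using diagram_down_closed[OF assms] by blast
next
  assume "(i, j) \<in> diagram \<pi> \<and> (Suc i, Suc j) \<notin> diagram \<pi>"
  moreover have "(Suc i, Suc j) \<in> corners (i, j)" by (simp add: corners_def)
  ultimately show "(i, j) \<in> rim (diagram \<pi>)"
    unfolding rim_def boundary_points_def by blast
qed

definition adjacent :: "nat \<times> nat \<Rightarrow> nat \<times> nat \<Rightarrow> bool" where
  "adjacent c d \<longleftrightarrow>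
     fst c = fst d \<and> (snd c = Suc (snd d) \<or> snd d = Suc (snd c)) \<or>
     snd c = snd d \<and> (fst c = Suc (fst d) \<or> fst d = Suc (fst c))"

definition connected_cells :: "(nat \<times> nat) set \<Rightarrow> bool" where
  "connected_cells H \<longleftrightarrow>
     (\<forall>c \<in> H. \<forall>d \<in> H. (\<lambda>x y. x \<in> H \<and> y \<in> H \<and> adjacent x y)\<^sup>*\<^sup>* c d)"

definition rim_hook :: "nat list \<Rightarrow> (nat \<times> nat) set \<Rightarrow> bool" where
  "rim_hook \<pi> H \<longleftrightarrow>
     H \<noteq> {} \<and> H \<subseteq> rim (diagram \<pi>) \<and> connected_cells H \<and>
     (\<exists>\<mu>. is_partition \<mu> \<and> diagram \<pi> - H = diagram \<mu>)"

definition is_core :: "nat \<Rightarrow> nat list \<Rightarrow> bool" where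
  "is_core t \<pi> \<longleftrightarrow> is_partition \<pi> \<and> \<not> (\<exists>H. rim_hook \<pi> H \<and> card H = t)"

text \<open>
  The cardinality of an infinite set is 0 in HOL; since the Catalan-type number that \<open>nu s t\<close> is
  compared with is positive, equality with it entails that the set of values is finite.
\<close>

definition nu :: "nat \<Rightarrow> nat \<Rightarrow> nat" where
  "nu s t = card {GBG_rank \<pi> s | \<pi>. is_core t \<pi>}"

definition smallest_prime_divisor :: "nat \<Rightarrow> nat" where
  "smallest_prime_divisor s = (LEAST p. prime p \<and> p dvd s)"

end

theory Submission
  imports Defs "Jordan_Normal_Form.Char_Poly" "HOL-Computational_Algebra.Polynomial_FPS"
begin

text \<open>
  Encode a partition by its beads \<open>\<pi>\<^sub>i - i\<close>. It is a \<open>t\<close>-core iff subtracting \<open>t\<close> from a bead always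
  gives a bead, and then it is determined by the top beads of the \<open>t\<close> residue classes modulo \<open>t\<close>, which
  are arbitrary up to the value of their sum. Summing geometric series over rows and classes shows that
  the GBG-rank is an injective affine function of the sum of \<open>\<omega> ^ x\<close> over the top beads \<open>x\<close>. By the
  Chinese remainder theorem the residues of the top beads modulo \<open>s\<close> form an arbitrary multiset of size
  \<open>t\<close> with prescribed sum modulo \<open>s\<close>. Cyclic shifts show that there are \<open>((s + t - 1) choose t) / s\<close> of
  these, which is the right-hand side, so the question is whether the sum of \<open>\<omega> ^ a\<close> over such a
  multiset determines it.

  If two multisets have the same sum, so they have after replacing \<open>\<omega>\<close> by a Galois conjugate \<open>\<omega> ^ j\<close>
  with \<open>j\<close> coprime to \<open>s\<close>. For \<open>s\<close> prime these are enough roots to make the difference of the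
  generating polynomials vanish. In general they contain all \<open>j < p\<close> for the smallest prime divisor
  \<open>p\<close>, so that the power sums up to \<open>p - 1\<close> of the roots of unity agree; together with
  the product and complex conjugation these determine all elementary symmetric functions when \<open>t < 2 * p\<close>.
  If \<open>s\<close> is composite and \<open>t > 2 * p\<close>, there is room for two cosets of the group of \<open>p\<close>-th roots of
  unity, which have sum zero and can be rotated against each other.
\<close>

section \<open>Galois conjugates of vanishing sums of roots of unity\<close>

lemma omega_power_eq: "s > 0 \<Longrightarrow> omega s ^ k = cis (2 * pi * real k / real s)"
  by (simp add: omega_def cis_conv_exp exp_of_nat_mult [symmetric] field_simps)

lemma omega_power_self [simp]: "s > 0 \<Longrightarrow> omega s ^ s = 1"
  by (simp add: omega_power_eq)

lemma norm_omega [simp]: "norm (omega s) = 1"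
  by (simp add: omega_def norm_exp_eq_Re)

lemma omega_neq_0 [simp]: "omega s \<noteq> 0"
  by (simp add: omega_def)

lemma omega_power_mod: "s > 0 \<Longrightarrow> omega s ^ (k mod s) = omega s ^ k"
  by (metis div_mult_mod_eq mult.commute mult_1 omega_power_self power_add power_mult power_one)

lemma inj_on_omega_power: "s > 0 \<Longrightarrow> inj_on (\<lambda>k. omega s ^ k) {..<s}"
  using bij_betw_roots_unity[of s] by (simp add: omega_power_eq bij_betw_def)

lemma omega_power_eq_1_iff: "s > 0 \<Longrightarrow> omega s ^ k = 1 \<longleftrightarrow> s dvd k"
proof -
  assume s: "s > 0"
  have "omega s ^ k = 1 \<longleftrightarrow> omega s ^ (k mod s) = omega s ^ 0"
    using s by (simp add: omega_power_mod)
  also have "\<dots> \<longleftrightarrow> k mod s = 0"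
    using inj_onD[OF inj_on_omega_power[OF s], of "k mod s" 0] s by auto
  finally show ?thesis by (simp add: dvd_eq_mod_eq_0)
qed

lemma sum_omega_power:
  assumes "s > 0"
  shows "(\<Sum>k<s. omega s ^ (k * n)) = (if s dvd n then of_nat s else 0)"
proof -
  have eq: "(\<Sum>k<s. omega s ^ (k * n)) = (\<Sum>k<s. (omega s ^ n) ^ k)"
    by (simp add: power_mult [symmetric] mult.commute)
  show ?thesis
  proof (cases "s dvd n")
    case True
    then show ?thesis using assms omega_power_eq_1_iff[of s n] by (simp add: eq)
  next
    case False
    then have "omega s ^ n \<noteq> 1" using assms omega_power_eq_1_iff by blast
    moreover have "(omega s ^ n) ^ s = 1"
      by (metis assms mult.commute omega_power_self power_mult power_one)
    ultimately show ?thesis using False by (simp add: eq geometric_sum)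
  qed
qed

section \<open>Integer polynomials evaluated at roots of unity\<close>

abbreviation ipoly :: "int poly \<Rightarrow> complex \<Rightarrow> complex" where
  "ipoly P z \<equiv> poly (of_int_poly P) z"

text \<open>For \<open>j < s\<close> these are the coefficients of the remainder of \<open>P\<close>
  modulo \<open>X ^ s - 1\<close>.\<close>

definition cyclic_coeff :: "nat \<Rightarrow> int poly \<Rightarrow> nat \<Rightarrow> int" where
  "cyclic_coeff s P j = (\<Sum>n | n \<le> degree P \<and> n mod s = j. coeff P n)"

lemma ipoly_cyclic:
  assumes "s > 0" "z ^ s = 1"
  shows "ipoly P z = (\<Sum>j<s. of_int (cyclic_coeff s P j) * z ^ j)"
proof -
  have "z ^ (n mod s) = z ^ n" for n
    by (metis assms(2) div_mult_mod_eq mult.commute mult_1 power_add power_mult power_one)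
  then have "of_int (cyclic_coeff s P j) * z ^ j
      = (\<Sum>n | n \<in> {..degree P} \<and> n mod s = j. of_int (coeff P n) * z ^ n)" for j
    unfolding cyclic_coeff_def of_int_sum sum_distrib_right by (intro sum.cong) auto
  then have "(\<Sum>j<s. of_int (cyclic_coeff s P j) * z ^ j)
      = (\<Sum>j<s. \<Sum>n | n \<in> {..degree P} \<and> n mod s = j. of_int (coeff P n) * z ^ n)"
    by simp
  also have "\<dots> = (\<Sum>n\<in>{..degree P}. of_int (coeff P n) * z ^ n)"
    by (rule sum.group) (use assms in auto)
  finally show ?thesis by (simp add: poly_altdef)
qed

text \<open>Inverse discrete Fourier transform: \<open>s\<close> times a cyclic coefficient is a
  combination of the \<open>s\<close> values with unimodular weights, hence below \<open>s\<close>
  in absolute value, and an integer below 1 is 0.\<close>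

lemma ipoly_omega_eq_0_if_small:
  assumes s: "s > 0" and small: "\<And>k. k < s \<Longrightarrow> norm (ipoly P (omega s ^ k)) < 1"
  shows "ipoly P (omega s ^ k) = 0"
proof -
  let ?q = "cyclic_coeff s P"
  have pw: "(omega s ^ k) ^ s = 1" for k
    using s by (metis mult.commute omega_power_self power_mult power_one)
  note ev = ipoly_cyclic[OF s pw, of P]
  have "?q j = 0" if j: "j < s" for j
  proof -
    \<comment> \<open>The weight is the inverse of \<open>omega s ^ (k * j)\<close>, written with a
      natural exponent.\<close>
    have "(\<Sum>k<s. ipoly P (omega s ^ k) * omega s ^ (k * (s - j)))
        = (\<Sum>k<s. \<Sum>i<s. of_int (?q i) * omega s ^ (k * (i + (s - j))))"
      by (simp add: ev sum_distrib_right power_mult [symmetric] power_add [symmetric]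
          distrib_left mult.assoc)
    also have "\<dots> = (\<Sum>i<s. of_int (?q i) * (\<Sum>k<s. omega s ^ (k * (i + (s - j)))))"
      by (subst sum.swap) (simp add: sum_distrib_left)
    also have "\<dots> = (\<Sum>i<s. of_int (?q i) * (if i = j then of_nat s else 0))"
    proof (intro sum.cong refl)
      fix i assume i: "i \<in> {..<s}"
      have "s dvd i + (s - j) \<longleftrightarrow> i = j"
      proof
        assume "s dvd i + (s - j)"
        then obtain m where m: "i + (s - j) = s * m" by auto
        have "0 < i + (s - j)" "i + (s - j) < s * 2" using i j by auto
        then have "m = 1" using m s by (simp add: less_Suc_eq)
        then show "i = j" using m j by simp
      qed (use j in auto)
      then show "of_int (?q i) * (\<Sum>k<s. omega s ^ (k * (i + (s - j))))
          = of_int (?q i) * (if i = j then of_nat s else 0)"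
        by (simp only: sum_omega_power[OF s])
    qed
    also have "\<dots> = of_int (?q j) * of_nat s"
      using j by (simp add: if_distrib[of "\<lambda>x. _ * x"] sum.delta cong: if_cong)
    finally have eq: "of_int (?q j) * of_nat s
        = (\<Sum>k<s. ipoly P (omega s ^ k) * omega s ^ (k * (s - j)))" ..
    have "norm (of_int (?q j) * of_nat s :: complex) \<le> (\<Sum>k<s. norm (ipoly P (omega s ^ k)))"
      unfolding eq by (rule order.trans[OF norm_sum]) (simp add: norm_mult norm_power)
    also have "\<dots> < (\<Sum>k<s. 1)"
      by (rule sum_strict_mono) (use s small in auto)
    finally have "\<bar>real_of_int (?q j)\<bar> * real s < real s" by (simp add: norm_mult)
    then have "\<bar>real_of_int (?q j)\<bar> < 1" using s by simp
    then show ?thesis by linarith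
  qed
  then show ?thesis by (simp add: ev)
qed

text \<open>The polynomial is the characteristic polynomial of multiplication by \<open>P\<close> on
  \<open>\<int>[X] / (X ^ s - 1)\<close>, which is given by a circulant matrix.\<close>

lemma ex_common_annihilator:
  assumes s: "s > 0"
  shows "\<exists>\<chi>. \<chi> \<noteq> 0 \<and> (\<forall>k. ipoly \<chi> (ipoly P (omega s ^ k)) = 0)"
proof -
  define A :: "int mat" where
    "A = mat s s (\<lambda>(i, j). (\<Sum>n | n \<in> {..<s} \<and> (i + n) mod s = j. cyclic_coeff s P n))"
  have A: "A \<in> carrier_mat s s" by (simp add: A_def)
  have "ipoly (char_poly A) (ipoly P (omega s ^ k)) = 0" for k
  proof -
    let ?A = "map_mat of_int A :: complex mat"
    let ?w = "omega s ^ k"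
    have w: "?w ^ s = 1"
      using s by (metis mult.commute omega_power_self power_mult power_one)
    have wmod: "?w ^ (n mod s) = ?w ^ n" for n
      by (metis w div_mult_mod_eq mult.commute mult_1 power_add power_mult power_one)
    \<comment> \<open>This vector is the evaluation of the basis of powers of \<open>X\<close> at
      \<open>?w\<close>, so the circulant multiplies it by the value of \<open>P\<close> at
      \<open>?w\<close>.\<close>
    define v where "v = vec s (\<lambda>j. ?w ^ j)"
    have "?A *\<^sub>v v = ipoly P ?w \<cdot>\<^sub>v v"
    proof (rule eq_vecI)
      fix i assume "i < dim_vec (ipoly P ?w \<cdot>\<^sub>v v)"
      then have i: "i < s" by (simp add: v_def)
      have "(?A *\<^sub>v v) $ i = (\<Sum>j<s. of_int (A $$ (i, j)) * ?w ^ j)"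
        using i by (simp add: A_def v_def scalar_prod_def lessThan_atLeast0)
      also have "\<dots> = (\<Sum>j<s. \<Sum>n | n \<in> {..<s} \<and> (i + n) mod s = j.
          of_int (cyclic_coeff s P n) * ?w ^ (i + n))"
      proof (intro sum.cong refl)
        fix j assume "j \<in> {..<s}"
        then show "of_int (A $$ (i, j)) * ?w ^ j = (\<Sum>n | n \<in> {..<s} \<and> (i + n) mod s = j.
          of_int (cyclic_coeff s P n) * ?w ^ (i + n))"
          using i unfolding A_def
          by (auto simp: sum_distrib_right wmod[of "i + _", symmetric] intro!: sum.cong)
      qed
      also have "\<dots> = (\<Sum>n<s. of_int (cyclic_coeff s P n) * ?w ^ (i + n))"
        by (rule sum.group) (use s in auto)
      also have "\<dots> = (ipoly P ?w \<cdot>\<^sub>v v) $ i"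
        using i by (simp add: v_def ipoly_cyclic[OF s w] sum_distrib_left power_add mult_ac)
      finally show "(?A *\<^sub>v v) $ i = (ipoly P ?w \<cdot>\<^sub>v v) $ i" .
    qed (simp add: A_def v_def)
    moreover have "v $ 0 \<noteq> 0\<^sub>v s $ 0" using s by (simp add: v_def)
    then have "v \<noteq> 0\<^sub>v s" by metis
    ultimately have "eigenvalue ?A (ipoly P ?w)"
      unfolding eigenvalue_def eigenvector_def by (intro exI[of _ v]) (simp add: A_def v_def)
    then show ?thesis
      using A by (subst (asm) eigenvalue_root_char_poly[of _ s])
        (simp_all add: of_int_hom.char_poly_hom[OF A])
  qed
  moreover have "char_poly A \<noteq> 0"
    using degree_monic_char_poly[OF A] by auto
  ultimately show ?thesis by blast
qed

text \<open>Removing all factors \<open>X\<close> from the annihilator leaves \<open>\<psi>\<close>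
  with nonzero constant term \<open>D\<close> that still kills every nonzero value of
  \<open>P\<close>. The composite \<open>D - \<psi>(P)\<close> is then the required
  indicator.\<close>

lemma ex_support_indicator:
  assumes s: "s > 0"
  shows "\<exists>F D. D \<noteq> (0 :: int) \<and>
    (\<forall>k. ipoly F (omega s ^ k) = (if ipoly P (omega s ^ k) = 0 then 0 else of_int D))"
proof -
  obtain \<chi> where \<chi>: "\<chi> \<noteq> 0" "\<And>k. ipoly \<chi> (ipoly P (omega s ^ k)) = 0"
    using ex_common_annihilator[OF s] by blast
  obtain \<psi> where \<psi>: "\<chi> = [:-0, 1:] ^ order 0 \<chi> * \<psi>" "\<not> [:-0, 1:] dvd \<psi>"
    using order_decomp[OF \<chi>(1), of 0] by blast
  define D where "D = poly \<psi> 0"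
  have D: "D \<noteq> 0" using \<psi>(2) by (simp add: D_def poly_eq_0_iff_dvd del: pCons_0_0)
  have \<psi>D: "ipoly \<psi> 0 = of_int D"
    by (metis D_def of_int_0 of_int_hom.poly_map_poly)
  have const: "ipoly [:D:] z = of_int D" for z by (simp add: of_int_hom.map_poly_pCons_hom)
  have ev: "ipoly ([:D:] - \<psi> \<circ>\<^sub>p P) z = of_int D - ipoly \<psi> (ipoly P z)" for z
    by (simp add: of_int_poly_hom.hom_minus of_int_hom.map_poly_pcompose poly_pcompose const)
  have "ipoly \<psi> x = 0" if "ipoly \<chi> x = 0" "x \<noteq> 0" for x
    using that by (subst (asm) \<psi>(1)) (simp add: of_int_poly_hom.hom_mult of_int_poly_hom.hom_power)
  then have "ipoly ([:D:] - \<psi> \<circ>\<^sub>p P) (omega s ^ k) =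
      (if ipoly P (omega s ^ k) = 0 then 0 else of_int D)" for k
    using \<chi>(2)[of k] by (simp add: ev \<psi>D D_def[symmetric])
  with D show ?thesis by blast
qed

section \<open>Frobenius congruence modulo a prime\<close>

lemma prime_dvd_power_add:
  fixes x y :: "'a :: comm_ring_1"
  assumes l: "prime l"
  shows "of_nat l dvd (x + y) ^ l - x ^ l - y ^ l"
proof -
  have l0: "l > 0" using l by (simp add: prime_gt_0_nat)
  have "(x + y) ^ l = (\<Sum>k\<le>l. of_nat (l choose k) * x ^ k * y ^ (l - k))"
    by (rule binomial_ring)
  also have "{..l} = insert 0 (insert l {0<..<l})" using l0 by auto
  also have "(\<Sum>k\<in>\<dots>. of_nat (l choose k) * x ^ k * y ^ (l - k))
      = y ^ l + (x ^ l + (\<Sum>k\<in>{0<..<l}. of_nat (l choose k) * x ^ k * y ^ (l - k)))"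
    using l0 by simp
  finally have "(x + y) ^ l - x ^ l - y ^ l
      = (\<Sum>k\<in>{0<..<l}. of_nat (l choose k) * x ^ k * y ^ (l - k))"
    by simp
  also have "of_nat l dvd \<dots>"
  proof (intro dvd_sum)
    fix k assume "k \<in> {0<..<l}"
    then have "l dvd (l choose k)" using l by (intro dvd_choose_prime) auto
    then show "of_nat l dvd (of_nat (l choose k) * x ^ k * y ^ (l - k) :: 'a)"
      by (metis dvd_mult2 dvd_def of_nat_mult)
  qed
  finally show ?thesis .
qed

lemma prime_dvd_power_minus_self_int:
  fixes a :: int
  assumes l: "prime l"
  shows "int l dvd a ^ l - a"
proof -
  define b where "b = nat (a mod int l)"
  have l0: "l > 0" using l by (simp add: prime_gt_0_nat)
  have b: "[a = int b] (mod int l)"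
    using l0 by (simp add: b_def cong_def)
  have "[b ^ l = b] (mod l)"
  proof (cases "l dvd b")
    case True
    then show ?thesis
      using l0 by (simp add: cong_def dvd_power_iff mod_0_imp_dvd dvd_imp_mod_0 dvd_trans[OF _ dvd_power])
  next
    case False
    then have "[b ^ (l - 1) * b = 1 * b] (mod l)"
      by (intro cong_scalar_right fermat_theorem l)
    then show ?thesis using l0 by (simp add: power_eq_if mult.commute)
  qed
  then have "[int b ^ l = int b] (mod int l)"
    by (metis cong_int_iff of_nat_power)
  then have "[a ^ l = a] (mod int l)"
    by (metis b cong_pow cong_sym cong_trans)
  then show ?thesis by (simp add: cong_iff_dvd_diff)
qed

lemma int_poly_frobenius:
  fixes P :: "int poly"
  assumes l: "prime l"
  shows "of_nat l dvd P ^ l - P \<circ>\<^sub>p monom 1 l"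
proof (induction P)
  case 0
  show ?case using l by (simp add: power_0_left prime_gt_0_nat)
next
  case (pCons a P)
  let ?X = "monom 1 1 :: int poly"
  have split: "pCons a P = [:a:] + ?X * P" by (simp add: monom_altdef)
  have "of_nat l dvd (pCons a P) ^ l - [:a:] ^ l - (?X * P) ^ l"
    unfolding split by (rule prime_dvd_power_add[OF l])
  moreover have "of_nat l dvd [:a:] ^ l - [:a:]"
  proof -
    obtain b where "a ^ l - a = int l * b"
      using prime_dvd_power_minus_self_int[OF l] by (auto elim: dvdE)
    then have "[:a:] ^ l - [:a:] = of_nat l * [:b:]"
      by (simp add: poly_const_pow of_nat_poly)
    then show ?thesis by (rule dvdI)
  qed
  moreover have "of_nat l dvd monom 1 l * (P ^ l - P \<circ>\<^sub>p monom 1 l)"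
    using pCons.IH by simp
  moreover have "pCons a P ^ l - pCons a P \<circ>\<^sub>p monom 1 l
      = (pCons a P ^ l - [:a:] ^ l - (?X * P) ^ l) + ([:a:] ^ l - [:a:])
        + monom 1 l * (P ^ l - P \<circ>\<^sub>p monom 1 l)"
    by (simp add: pcompose_pCons power_mult_distrib monom_power algebra_simps)
  ultimately show ?case by (metis dvd_add)
qed

text \<open>With \<open>F\<close> equal to \<open>D\<close> times an idempotent of \<open>\<rat>[X] / (X ^ s - 1)\<close>, one has
  \<open>F(X ^ l) \<equiv> F ^ l \<equiv> F\<close> modulo \<open>l\<close>, and for \<open>l > \<bar>D\<bar>\<close> the congruence is an equality.\<close>

lemma ipoly_prime_power_eq_0_iff:
  assumes s: "s > 0"
  shows "\<exists>B. \<forall>l k. prime l \<longrightarrow> l > B \<longrightarrow>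
    (ipoly P (omega s ^ (l * k)) = 0 \<longleftrightarrow> ipoly P (omega s ^ k) = 0)"
proof -
  obtain F D where D: "D \<noteq> (0 :: int)"
    and F: "\<And>k. ipoly F (omega s ^ k) = (if ipoly P (omega s ^ k) = 0 then 0 else of_int D)"
    using ex_support_indicator[OF s, of P] by blast
  have "ipoly P (omega s ^ (l * k)) = 0 \<longleftrightarrow> ipoly P (omega s ^ k) = 0"
    if l: "prime l" and lD: "l > nat \<bar>D\<bar>" for l k
  proof -
    have l1: "l > 1" using l by (simp add: prime_gt_Suc_0_nat)
    have "\<not> int l dvd D"
      using D lD by (metis dvd_imp_le_int int_nat_eq linorder_not_less nat_int nat_less_iff abs_ge_zero abs_of_nat zless_nat_conj not_le of_nat_less_iff)
    moreover have "D ^ l - D = D * (D ^ (l - 1) - 1)"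
      using l1 by (simp add: algebra_simps flip: power_Suc)
    ultimately have "int l dvd D ^ (l - 1) - 1"
      using prime_dvd_power_minus_self_int[OF l, of D] l
      by (metis prime_dvd_mult_iff prime_nat_int_transfer)
    then obtain m where m: "D ^ (l - 1) - 1 = int l * m"
      by (auto elim: dvdE)
    obtain Q where Q: "F ^ l - F \<circ>\<^sub>p monom 1 l = of_nat l * Q"
      using int_poly_frobenius[OF l, of F] by (auto elim: dvdE)
    \<comment> \<open>On the roots of unity \<open>F\<close> is 0 or \<open>D\<close>, so
      \<open>F ^ l\<close> equals \<open>D ^ (l - 1) * F = F + l * m * F\<close> there. Hence
      \<open>Q'\<close> takes there the values of \<open>(F - F(X ^ l)) / l\<close>.\<close>
    define Q' where "Q' = Q - smult m F"
    have diff: "of_nat l * ipoly Q' (omega s ^ k) = ipoly F (omega s ^ k) - ipoly F (omega s ^ (l * k))" for k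
    proof -
      let ?w = "omega s ^ k"
      have "ipoly F ?w ^ l = ipoly F ?w * of_int (D ^ (l - 1))"
        using l1 by (simp add: F power_0_left flip: power_Suc)
      also have "\<dots> = ipoly F ?w + ipoly F ?w * of_int (int l * m)"
        unfolding m[symmetric] by (simp add: algebra_simps)
      finally have 1: "ipoly F ?w ^ l = ipoly F ?w + of_nat l * (of_int m * ipoly F ?w)" by simp
      have "ipoly (F ^ l - F \<circ>\<^sub>p monom 1 l) ?w = ipoly (of_nat l * Q) ?w" by (simp only: Q)
      then have 2: "ipoly F ?w ^ l - ipoly F (omega s ^ (l * k)) = of_nat l * ipoly Q ?w"
        by (simp add: of_int_poly_hom.hom_minus of_int_poly_hom.hom_mult of_int_poly_hom.hom_power
            of_int_hom.map_poly_pcompose poly_pcompose poly_monom of_nat_poly of_int_hom.map_poly_hom_smult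
            power_mult [symmetric] mult.commute)
      show ?thesis using 1 2
        by (simp add: Q'_def of_int_poly_hom.hom_minus of_int_hom.map_poly_hom_smult algebra_simps)
    qed
    \<comment> \<open>Two numbers from \<open>{0, D}\<close> differ by at most the absolute value of
      \<open>D\<close>, which is less than \<open>l\<close>.\<close>
    have "norm (ipoly Q' (omega s ^ k)) < 1" for k
    proof -
      have "real l * norm (ipoly Q' (omega s ^ k)) = norm (of_nat l * ipoly Q' (omega s ^ k))"
        by (simp add: norm_mult)
      also have "\<dots> \<le> real_of_int \<bar>D\<bar>" unfolding diff F by simp
      also have "\<dots> < real l * 1" using lD by linarith
      finally show ?thesis using l1 by (simp only: mult_less_cancel_left_pos of_nat_0_less_iff)
    qed
    then have "ipoly Q' (omega s ^ k) = 0"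
      by (intro ipoly_omega_eq_0_if_small[OF s]) auto
    then show ?thesis using diff[of k] D by (auto simp: F split: if_splits)
  qed
  then show ?thesis by blast
qed

text \<open>The exponent \<open>j\<close> is replaced by a congruent one without small prime factors.\<close>

lemma ipoly_omega_conjugate:
  assumes s: "s > 0" and P: "ipoly P (omega s) = 0" and j: "coprime j s"
  shows "ipoly P (omega s ^ j) = 0"
proof -
  obtain B where B: "\<And>l k. prime l \<Longrightarrow> l > B \<Longrightarrow>
      ipoly P (omega s ^ (l * k)) = 0 \<longleftrightarrow> ipoly P (omega s ^ k) = 0"
    using ipoly_prime_power_eq_0_iff[OF s] by blast
  \<comment> \<open>Every prime up to \<open>B\<close> divides exactly one of \<open>j\<close> and
    \<open>s * m\<close>: a divisor of \<open>j\<close> divides neither \<open>s\<close> nor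
    \<open>m\<close>, any other one divides \<open>m\<close>. So it cannot divide
    \<open>j'\<close>.\<close>
  define m where "m = (\<Prod>q | prime q \<and> q \<le> B \<and> \<not> q dvd j. q)"
  have fin: "finite {q. prime q \<and> q \<le> B \<and> \<not> q dvd j}" by simp
  define j' where "j' = j + s * m"
  have m0: "m > 0" unfolding m_def by (intro prod_pos) (auto simp: prime_gt_0_nat)
  have large: "q > B" if q: "prime q" "q dvd j'" for q
  proof (rule ccontr)
    assume "\<not> q > B"
    show False
    proof (cases "q dvd j")
      case True
      then have "q dvd s * m" using q by (simp add: j'_def dvd_add_right_iff)
      moreover have "\<not> q dvd s" using True j q(1) by (metis coprime_common_divisor not_prime_unit)
      ultimately have "q dvd m" using q(1) by (simp add: prime_dvd_mult_iff)
      then obtain r where r: "prime r" "\<not> r dvd j" "q dvd r"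
        unfolding m_def using q(1) prime_dvd_prod_iff[OF fin, of q "\<lambda>q. q"] by auto
      then show False using True q(1) by (metis primes_dvd_imp_eq)
    next
      case False
      then have "q dvd m" using q(1) \<open>\<not> q > B\<close> unfolding m_def
        by (intro dvd_prodI[OF fin, of q "\<lambda>q. q"]) auto
      then show False using False q(2) by (simp add: j'_def dvd_add_left_iff)
    qed
  qed
  \<comment> \<open>Starting from exponent 1, the prime factors of \<open>n\<close> are multiplied
    in one at a time.\<close>
  have "ipoly P (omega s ^ n) = 0" if "n > 0" "\<And>q. prime q \<Longrightarrow> q dvd n \<Longrightarrow> q > B" for n
    using that
  proof (induction n rule: less_induct)
    case (less n)
    show ?case
    proof (cases "n = 1")
      case False
      then obtain q where q: "prime q" "q dvd n" using prime_factor_nat by blast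
      then obtain n' where n': "n = q * n'" by auto
      have "ipoly P (omega s ^ n') = 0"
        using less q n' by (intro less.IH) (auto simp: prime_gt_Suc_0_nat)
      then show ?thesis using B[OF q(1)] less.prems(2) q by (simp add: n')
    qed (use P in simp)
  qed
  moreover have "j' > 0" using s m0 by (simp add: j'_def)
  ultimately have "ipoly P (omega s ^ j') = 0" using large by blast
  moreover have "omega s ^ j' = omega s ^ j"
    using s by (metis j'_def mod_mult_self2 omega_power_mod)
  ultimately show ?thesis by simp
qed

section \<open>Unimodular numbers with given power sums\<close>

text \<open>The coefficients are the elementary symmetric functions up to sign; the constant term 1
  makes this a unit among power series.\<close>

definition recip_poly :: "complex multiset \<Rightarrow> complex poly" where
  "recip_poly M = (\<Prod>z\<in>#M. [:1, -z:])"

lemma recip_poly_empty [simp]: "recip_poly {#} = 1"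
  by (simp add: recip_poly_def)

lemma recip_poly_add [simp]: "recip_poly (add_mset z M) = [:1, -z:] * recip_poly M"
  by (simp add: recip_poly_def)

lemma recip_poly_neq_0 [simp]: "recip_poly M \<noteq> 0"
  by (simp add: recip_poly_def prod_mset_zero_iff image_iff)

lemma coeff_recip_poly_0 [simp]: "coeff (recip_poly M) 0 = 1"
  by (induction M) (auto simp: coeff_mult_0)

lemma degree_recip_poly: "0 \<notin># M \<Longrightarrow> degree (recip_poly M) = size M"
  by (induction M) (auto simp: degree_mult_eq simp del: mult_pCons_left)

text \<open>Logarithmic derivative: each factor \<open>1 - z X\<close> contributes a geometric
  series, and these add up to the generating function of the power sums.\<close>

lemma fps_deriv_recip_poly:
  "fps_deriv (fps_of_poly (recip_poly M)) =
     - (fps_of_poly (recip_poly M) * Abs_fps (\<lambda>n. \<Sum>z\<in>#M. z ^ Suc n))"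
proof (induction M)
  case (add z M)
  let ?A = "fps_of_poly (recip_poly M)" and ?S = "Abs_fps (\<lambda>n. \<Sum>z\<in>#M. z ^ Suc n)"
  let ?G = "Abs_fps (\<lambda>n. z ^ Suc n)" and ?L = "fps_of_poly [:1, -z:]"
  have G: "?L * ?G = fps_const z"
  proof (rule fps_ext)
    fix n
    have "?L * ?G = ?G - fps_const z * (fps_X * ?G)"
      by (simp add: fps_of_poly_pCons algebra_simps flip: fps_const_neg)
    then show "fps_nth (?L * ?G) n = fps_nth (fps_const z) n" by (cases n) auto
  qed
  have L: "fps_deriv ?L = - fps_const z"
    by (simp add: fps_of_poly_pCons)
  have S: "Abs_fps (\<lambda>n. \<Sum>z\<in>#add_mset z M. z ^ Suc n) = ?G + ?S"
    by (rule fps_ext) simp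
  have "fps_deriv (?L * ?A) = - (?L * ?A * (?G + ?S))"
    using G by (simp add: L add.IH algebra_simps)
  then show ?case by (simp only: S recip_poly_add fps_of_poly_mult)
qed (simp add: fps_zero_def [symmetric])

lemma newton_recip_poly:
  "of_nat (Suc n) * coeff (recip_poly M) (Suc n) =
     - (\<Sum>k\<le>n. coeff (recip_poly M) k * (\<Sum>z\<in>#M. z ^ Suc (n - k)))"
  using arg_cong[OF fps_deriv_recip_poly[of M], of "\<lambda>f. fps_nth f n"]
  by (simp add: fps_mult_nth atLeast0AtMost)

text \<open>Newton's identities determine the coefficients recursively, as \<open>Suc m\<close> is
  invertible in the complex numbers.\<close>

lemma coeff_recip_poly_cong:
  assumes "\<And>j. 0 < j \<Longrightarrow> j < p \<Longrightarrow> (\<Sum>z\<in>#M. z ^ j) = (\<Sum>z\<in>#N. z ^ j)" and "n < p"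
  shows "coeff (recip_poly M) n = coeff (recip_poly N) n"
  using assms(2)
proof (induction n rule: less_induct)
  case (less n)
  show ?case
  proof (cases n)
    case (Suc m)
    have "of_nat (Suc m) * coeff (recip_poly M) (Suc m)
        = of_nat (Suc m) * coeff (recip_poly N) (Suc m)"
      unfolding newton_recip_poly using less Suc
      by (intro arg_cong[of _ _ uminus] sum.cong arg_cong2[of _ _ _ _ "(*)"] assms(1)) auto
    then show ?thesis unfolding Suc using of_nat_neq_0[of m, where 'a = complex] by (metis mult_cancel_left)
  qed simp
qed

lemma coeff_recip_poly_cnj:
  "coeff (recip_poly (image_mset cnj M)) n = cnj (coeff (recip_poly M) n)"
  by (induction M arbitrary: n) (auto simp: coeff_pCons split: nat.splits)

lemma reflect_recip_poly: "reflect_poly (recip_poly M) = (\<Prod>z\<in>#M. [:-z, 1:])" if "0 \<notin># M"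
  using that by (induction M) (auto simp: reflect_poly_mult reflect_poly_pCons simp del: mult_pCons_left)

text \<open>On the unit circle \<open>cnj z\<close> is the inverse of \<open>z\<close>, so
  \<open>X - z = -z (1 - cnj z X)\<close>.\<close>

lemma reflect_recip_poly_unit:
  assumes "\<And>z. z \<in># M \<Longrightarrow> norm z = 1"
  shows "(\<Prod>z\<in>#M. [:-z, 1:]) = smult (\<Prod>z\<in>#M. - z) (recip_poly (image_mset cnj M))"
  using assms
proof (induction M)
  case (add z M)
  have "z * cnj z = 1"
    using add.prems[of z] by (simp flip: complex_norm_square)
  then have "[:-z, 1:] = smult (-z) [:1, - cnj z:]" by simp
  with add show ?case by (simp only: image_mset_add_mset prod_mset.add_mset recip_poly_add
      mult_smult_left mult_smult_right smult_smult mult_ac) simp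
qed simp

lemma coeff_recip_poly_flip:
  assumes "\<And>z. z \<in># M \<Longrightarrow> norm z = 1" and "j \<le> size M"
  shows "coeff (recip_poly M) (size M - j) = (\<Prod>z\<in>#M. - z) * cnj (coeff (recip_poly M) j)"
proof -
  have 0: "0 \<notin># M" using assms(1) by force
  have "coeff (reflect_poly (recip_poly M)) j
      = (\<Prod>z\<in>#M. - z) * cnj (coeff (recip_poly M) j)"
    using assms(1) by (simp add: reflect_recip_poly 0 reflect_recip_poly_unit coeff_recip_poly_cnj)
  then show ?thesis using assms(2) by (simp add: coeff_reflect_poly degree_recip_poly 0)
qed

lemma inj_recip_poly:
  assumes "recip_poly M = recip_poly N" "0 \<notin># M" "0 \<notin># N"
  shows "M = N"
proof -
  have "proots (\<Prod>z\<in>#M. [:-z, 1:]) = M" for M :: "complex multiset"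
  proof -
    have "0 \<notin># image_mset (\<lambda>z. [:-z, 1:]) M" by auto
    from proots_prod_mset[OF this] show ?thesis
      by (simp add: image_mset.compositionality o_def)
  qed
  then show ?thesis using assms by (metis reflect_recip_poly)
qed

text \<open>Newton's identities give the elementary symmetric functions below \<open>p\<close>; complex conjugation
  turns them, up to the product, into those of complementary degree.\<close>

lemma unit_multiset_eqI:
  fixes M N :: "complex multiset"
  assumes unit: "\<And>z. z \<in># M \<Longrightarrow> norm z = 1" "\<And>z. z \<in># N \<Longrightarrow> norm z = 1"
    and size: "size M = size N" "size M < 2 * p"
    and prod: "\<Prod>\<^sub># M = \<Prod>\<^sub># N"
    and psum: "\<And>j. 0 < j \<Longrightarrow> j < p \<Longrightarrow> (\<Sum>z\<in>#M. z ^ j) = (\<Sum>z\<in>#N. z ^ j)"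
  shows "M = N"
proof -
  have uminus: "(\<Prod>z\<in>#M. - z) = (- 1) ^ size M * \<Prod>\<^sub># M" for M :: "complex multiset"
    by (induction M) auto
  have 0: "0 \<notin># M" "0 \<notin># N" using unit by force+
  have "recip_poly M = recip_poly N"
  proof (rule poly_eqI)
    fix n
    consider "n < p" | "n > size M" | "n \<ge> p" "n \<le> size M" by linarith
    then show "coeff (recip_poly M) n = coeff (recip_poly N) n"
    proof cases
      case 1
      then show ?thesis using psum by (rule coeff_recip_poly_cong[rotated])
    next
      case 2
      then show ?thesis using size 0 by (simp add: coeff_eq_0 degree_recip_poly)
    next
      case 3
      \<comment> \<open>Here \<open>size M < 2 * p\<close> is used: with \<open>n \<ge> p\<close>
        the complementary degree is below \<open>p\<close>.\<close>
      have "coeff (recip_poly M) (size M - n) = coeff (recip_poly N) (size M - n)"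
        by (rule coeff_recip_poly_cong[of p]) (use psum 3 size in auto)
      moreover have "n = size M - (size M - n)" using 3 by simp
      ultimately show ?thesis
        using coeff_recip_poly_flip[of M "size M - n"] coeff_recip_poly_flip[of N "size M - n"] unit size
        by (simp add: uminus prod)
    qed
  qed
  then show ?thesis using 0 by (rule inj_recip_poly)
qed

section \<open>Multisets of residues\<close>

definition residue_multisets :: "nat \<Rightarrow> nat \<Rightarrow> nat \<Rightarrow> nat multiset set" where
  "residue_multisets s t c = {M \<in> multisets_of_size {..<s} t. [\<Sum>\<^sub># M = c] (mod s)}"

lemma finite_residue_multisets [simp]: "finite (residue_multisets s t c)"
  unfolding residue_multisets_def
  by (rule finite_subset[OF _ finite_multisets_of_size[of "{..<s}" t]]) auto

lemma residue_multisetsD: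
  assumes "M \<in> residue_multisets s t c"
  shows "set_mset M \<subseteq> {..<s}" "size M = t" "[\<Sum>\<^sub># M = c] (mod s)"
  using assms by (auto simp: residue_multisets_def multisets_of_size_def)

lemma image_mset_inj_on:
  assumes "inj_on f A" "set_mset M \<subseteq> A" "set_mset N \<subseteq> A" "image_mset f M = image_mset f N"
  shows "M = N"
proof -
  let ?g = "the_inv_into A f"
  have inv: "image_mset ?g (image_mset f K) = K" if "set_mset K \<subseteq> A" for K
    using that by (induction K) (auto simp: the_inv_into_f_f[OF assms(1)])
  have "M = image_mset ?g (image_mset f M)" using inv[OF assms(2)] by simp
  also have "\<dots> = N" unfolding assms(4) by (rule inv[OF assms(3)])
  finally show ?thesis .
qed

text \<open>Adding 1 modulo \<open>s\<close> to each of the \<open>t\<close> elements is injective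
  and raises the sum by \<open>t\<close>.\<close>

lemma card_residue_multisets_shift:
  assumes s: "s > 0"
  shows "card (residue_multisets s t c) \<le> card (residue_multisets s t (c + t))"
proof (rule card_inj_on_le)
  let ?f = "image_mset (\<lambda>x. Suc x mod s) :: nat multiset \<Rightarrow> nat multiset"
  have "inj_on (\<lambda>x. Suc x mod s) {..<s}"
    by (auto simp: inj_on_def mod_Suc split: if_splits)
  then show "inj_on ?f (residue_multisets s t c)"
    using residue_multisetsD(1) by (intro inj_onI) (rule image_mset_inj_on)
  have "[\<Sum>\<^sub># (?f M) = \<Sum>\<^sub># M + size M] (mod s)" for M
  proof (induction M)
    case (add x M)
    have "[Suc x mod s + \<Sum>\<^sub># (?f M) = Suc x + (\<Sum>\<^sub># M + size M)] (mod s)"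
      by (intro cong_add add.IH) simp
    then show ?case by (simp add: algebra_simps)
  qed simp
  then have sum: "[\<Sum>\<^sub># (?f M) = c + t] (mod s)" if "M \<in> residue_multisets s t c" for M
    using residue_multisetsD[OF that] cong_trans[OF _ cong_add[OF _ cong_refl]] by blast
  then show "?f ` residue_multisets s t c \<subseteq> residue_multisets s t (c + t)"
  proof (intro image_subsetI)
    fix M assume M: "M \<in> residue_multisets s t c"
    then have "set_mset (?f M) \<subseteq> {..<s}" "size (?f M) = t"
      using s residue_multisetsD(2) by auto
    with sum[OF M] show "?f M \<in> residue_multisets s t (c + t)"
      by (simp add: residue_multisets_def multisets_of_size_def)
  qed
qed simp

text \<open>As \<open>t\<close> is invertible modulo \<open>s\<close>, repeated shifts lead from any
  sum to any other, so the \<open>s\<close> sum classes have equal size. Together they contain all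
  multisets of size \<open>t\<close>.\<close>

lemma card_residue_multisets:
  assumes s: "s > 0" and st: "coprime s t"
  shows "s * card (residue_multisets s t c) = (s + t - 1) choose t"
proof -
  have cong: "residue_multisets s t a = residue_multisets s t b" if "[a = b] (mod s)" for a b
    using that by (simp add: residue_multisets_def cong_def)
  have le: "card (residue_multisets s t a) \<le> card (residue_multisets s t b)" for a b
  proof -
    have step: "card (residue_multisets s t a) \<le> card (residue_multisets s t (a + n * t))" for n
    proof (induction n)
      case (Suc n)
      then show ?case
        using card_residue_multisets_shift[OF s, of t "a + n * t"]
        by (simp add: algebra_simps)
    qed simp
    obtain x where x: "[t * x = 1] (mod s)"
      using st cong_solve_coprime_nat[of t s] by (auto simp: coprime_commute)
    \<comment> \<open>This solves \<open>a + n * t = b\<close> modulo \<open>s\<close>; the term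
      \<open>(s - 1) * a\<close> replaces \<open>- a\<close>.\<close>
    let ?n = "x * (b + (s - 1) * a)"
    have "[a + (t * x) * (b + (s - 1) * a) = a + 1 * (b + (s - 1) * a)] (mod s)"
      by (intro cong_add cong_mult x cong_refl)
    also have "a + 1 * (b + (s - 1) * a) = b + s * a"
      using s by (cases s) auto
    also have "[b + s * a = b] (mod s)" by (simp add: cong_def)
    finally have "[a + ?n * t = b] (mod s)" by (simp add: mult_ac)
    then show ?thesis using step[of ?n] cong by simp
  qed
  then have eq: "card (residue_multisets s t a) = card (residue_multisets s t c)" for a
    by (meson le_antisym)
  have "multisets_of_size {..<s} t = (\<Union>a<s. residue_multisets s t a)"
    using s by (auto simp: residue_multisets_def cong_def)
  also have "card \<dots> = (\<Sum>a<s. card (residue_multisets s t a))"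
    by (intro card_UN_disjoint ballI finite_residue_multisets)
      (auto simp: residue_multisets_def cong_def)
  also have "\<dots> = (\<Sum>a<s. card (residue_multisets s t c))"
    by (rule sum.cong[OF refl eq])
  finally show ?thesis by (simp add: card_multisets_of_size)
qed

section \<open>Injectivity of sums of roots of unity\<close>

definition omega_sum :: "nat \<Rightarrow> nat multiset \<Rightarrow> complex" where
  "omega_sum s M = (\<Sum>a\<in>#M. omega s ^ a)"

lemma power_sum_conjugate:
  assumes s: "s > 0" and eq: "omega_sum s M = omega_sum s N" and j: "coprime j s"
  shows "(\<Sum>a\<in>#M. (omega s ^ j) ^ a) = (\<Sum>a\<in>#N. (omega s ^ j) ^ a)"
proof -
  define P :: "int poly" where "P = (\<Sum>a\<in>#M. monom 1 a) - (\<Sum>a\<in>#N. monom 1 a)"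
  have "ipoly (\<Sum>a\<in>#M. monom 1 a) z = (\<Sum>a\<in>#M. z ^ a)" for M z
    by (induction M) (auto simp: of_int_poly_hom.hom_add poly_monom)
  then have P: "ipoly P z = (\<Sum>a\<in>#M. z ^ a) - (\<Sum>a\<in>#N. z ^ a)" for z
    by (simp add: P_def of_int_poly_hom.hom_minus)
  show ?thesis
    using ipoly_omega_conjugate[OF s, of P j] eq j by (simp add: P omega_sum_def)
qed

lemma smallest_prime_divisor:
  assumes "s > 1"
  shows "prime (smallest_prime_divisor s)" "smallest_prime_divisor s dvd s"
proof -
  obtain q where "prime q \<and> q dvd s"
    using assms prime_factor_nat[of s] by auto
  then have "prime (smallest_prime_divisor s) \<and> smallest_prime_divisor s dvd s"
    unfolding smallest_prime_divisor_def by (rule LeastI)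
  then show "prime (smallest_prime_divisor s)" "smallest_prime_divisor s dvd s" by auto
qed

lemma smallest_prime_divisor_le: "prime q \<Longrightarrow> q dvd s \<Longrightarrow> smallest_prime_divisor s \<le> q"
  unfolding smallest_prime_divisor_def by (rule Least_le) simp

lemma coprime_if_less_smallest_prime_divisor:
  assumes "0 < j" "j < smallest_prime_divisor s"
  shows "coprime j s"
proof (rule ccontr)
  assume "\<not> coprime j s"
  then obtain q where q: "prime q" "q dvd gcd j s"
    by (metis coprime_iff_gcd_eq_1 prime_factor_nat)
  have "smallest_prime_divisor s \<le> q"
    by (rule smallest_prime_divisor_le) (use q in simp_all)
  also have "q \<le> j" by (rule dvd_imp_le) (use q assms in simp_all)
  finally show False using assms by simp
qed

text \<open>The conjugates with exponents below the smallest prime divisor supply the power sums,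
  and the fixed sum of residues supplies the product.\<close>

lemma inj_on_omega_sum_small:
  assumes s: "s > 0" and t: "t < 2 * smallest_prime_divisor s"
  shows "inj_on (omega_sum s) (residue_multisets s t c)"
proof (rule inj_onI)
  fix M N
  assume M: "M \<in> residue_multisets s t c" and N: "N \<in> residue_multisets s t c"
    and eq: "omega_sum s M = omega_sum s N"
  let ?f = "image_mset (\<lambda>a. omega s ^ a)"
  have prod: "\<Prod>\<^sub># (?f K) = omega s ^ \<Sum>\<^sub># K" for K
    by (induction K) (auto simp: power_add)
  have "?f M = ?f N"
  proof (rule unit_multiset_eqI)
    show "size (?f M) = size (?f N)" "size (?f M) < 2 * smallest_prime_divisor s"
      using t residue_multisetsD(2)[OF M] residue_multisetsD(2)[OF N] by auto
    have "[\<Sum>\<^sub># M = \<Sum>\<^sub># N] (mod s)"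
      using residue_multisetsD(3)[OF M] residue_multisetsD(3)[OF N] by (metis cong_sym cong_trans)
    then show "\<Prod>\<^sub># (?f M) = \<Prod>\<^sub># (?f N)"
      unfolding prod using s by (metis cong_def omega_power_mod)
    fix j assume "0 < j" "j < smallest_prime_divisor s"
    then have "coprime j s" by (rule coprime_if_less_smallest_prime_divisor)
    from power_sum_conjugate[OF s eq this]
    show "(\<Sum>z\<in>#?f M. z ^ j) = (\<Sum>z\<in>#?f N. z ^ j)"
      by (simp add: image_mset.compositionality o_def mult.commute flip: power_mult)
  qed (auto simp: norm_power)
  then show "M = N"
    using image_mset_inj_on[OF inj_on_omega_power[OF s]]
      residue_multisetsD(1)[OF M] residue_multisetsD(1)[OF N] by blast
qed

text \<open>The difference of the generating polynomials has degree below \<open>s\<close> but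
  vanishes at all \<open>s\<close> roots of unity: at 1 by equal sizes, elsewhere by
  conjugation.\<close>

lemma inj_on_omega_sum_prime:
  assumes s: "prime s"
  shows "inj_on (omega_sum s) (residue_multisets s t c)"
proof (rule inj_onI)
  fix M N
  assume M: "M \<in> residue_multisets s t c" and N: "N \<in> residue_multisets s t c"
    and eq: "omega_sum s M = omega_sum s N"
  have s0: "s > 0" using s by (simp add: prime_gt_0_nat)
  define R :: "nat multiset \<Rightarrow> complex poly" where "R K = (\<Sum>a\<in>#K. monom 1 a)" for K
  have R: "poly (R K) z = (\<Sum>a\<in>#K. z ^ a)" for K z
    unfolding R_def by (induction K) (auto simp: poly_monom)
  have coeff: "coeff (R K) a = of_nat (count K a)" for K a
    unfolding R_def by (induction K) auto
  have deg: "degree (R K) < s" if "K \<in> residue_multisets s t c" for K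
  proof -
    have "degree (R K) \<le> s - 1"
    proof (rule degree_le, intro allI impI)
      fix a assume "s - 1 < a"
      then show "coeff (R K) a = 0"
        using residue_multisetsD(1)[OF that] by (auto simp: coeff count_eq_zero_iff)
    qed
    then show ?thesis using s0 by linarith
  qed
  have root: "poly (R M - R N) (omega s ^ j) = 0" if "j < s" for j
  proof (cases "j = 0")
    case True
    then show ?thesis
      using residue_multisetsD(2)[OF M] residue_multisetsD(2)[OF N] by (simp add: R)
  next
    case False
    then have "coprime j s"
      using that s by (metis coprime_commute prime_imp_coprime_nat nat_dvd_not_less neq0_conv)
    from power_sum_conjugate[OF s0 eq this] show ?thesis by (simp add: R)
  qed
  have "R M - R N = 0"
  proof (rule ccontr)
    assume nz: "R M - R N \<noteq> 0"
    have "s = card ((\<lambda>k. omega s ^ k) ` {..<s})"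
      using inj_on_omega_power[OF s0] by (simp add: card_image)
    also have "\<dots> \<le> card {z. poly (R M - R N) z = 0}"
      using root by (intro card_mono poly_roots_finite[OF nz]) auto
    also have "\<dots> \<le> degree (R M - R N)"
      by (rule card_poly_roots_bound[OF nz])
    also have "\<dots> < s" using deg[OF M] deg[OF N] by (intro degree_diff_less)
    finally show False by simp
  qed
  then have "R M = R N" by simp
  then show "M = N" by (metis coeff multiset_eqI of_nat_eq_iff)
qed

text \<open>Cosets of the subgroup of order \<open>p\<close> have vanishing sum, so two of them can be traded for two
  others with the same total weight, and one spare element adjusts the residue \<open>c\<close>.\<close>

lemma not_inj_on_omega_sum:
  assumes s: "s = p * u" and p: "p > 1" and u: "u > 1" and t: "2 * p < t"
  shows "\<not> inj_on (omega_sum s) (residue_multisets s t c)"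
proof
  assume inj: "inj_on (omega_sum s) (residue_multisets s t c)"
  have s0: "s > 0" using s p u by simp
  define C where "C a = image_mset (\<lambda>j. a + j * u) (mset_set {..<p})" for a
  have C_range: "set_mset (C a) \<subseteq> {..<s}" if "a < u" for a
  proof -
    have "a + j * u < s" if "j < p" for j
    proof -
      have "a + j * u < Suc j * u" using \<open>a < u\<close> by simp
      also have "\<dots> \<le> s" unfolding s using that by (intro mult_right_mono) auto
      finally show ?thesis .
    qed
    then show ?thesis by (auto simp: C_def)
  qed
  have C_size [simp]: "size (C a) = p" for a by (simp add: C_def)
  have C_sum: "\<Sum>\<^sub># (C a) = p * a + \<Sum>\<^sub># (C 0)" for a
    by (simp add: C_def sum_unfold_sum_mset [symmetric] sum.distrib)
  have C_omega: "omega_sum s (C a) = 0" for a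
  proof -
    have "omega s ^ u \<noteq> 1"
      using omega_power_eq_1_iff[OF s0, of u] s p u by (auto dest!: dvd_imp_le)
    moreover have "(omega s ^ u) ^ p = 1"
      using omega_power_self[OF s0] by (simp add: s mult.commute flip: power_mult)
    ultimately have "(\<Sum>j<p. (omega s ^ u) ^ j) = 0" by (simp add: geometric_sum)
    then have "(\<Sum>j<p. omega s ^ a * (omega s ^ u) ^ j) = 0"
      by (simp flip: sum_distrib_left)
    then show ?thesis
      by (simp add: omega_sum_def C_def image_mset.compositionality o_def sum_unfold_sum_mset
          power_add power_mult mult.commute[of _ u])
  qed
  \<comment> \<open>\<open>Z\<close> takes the coset of 0 twice, \<open>Y\<close> those of 1 and
    \<open>u - 1\<close>, which raises the sum by \<open>p + p * (u - 1) = s\<close>. Zeros and the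
    spare element \<open>e\<close> fill up to size \<open>t\<close>.\<close>
  define Z where "Z = C 0 + C 0 + replicate_mset (t - 2 * p - 1) 0"
  define Y where "Y = C 1 + C (u - 1) + replicate_mset (t - 2 * p - 1) 0"
  define e where "e = (c + (s - 1) * \<Sum>\<^sub># Z) mod s"
  have e: "[e + \<Sum>\<^sub># Z = c] (mod s)"
  proof -
    have "[e + \<Sum>\<^sub># Z = (c + (s - 1) * \<Sum>\<^sub># Z) + \<Sum>\<^sub># Z] (mod s)"
      unfolding e_def by (intro cong_add) auto
    also have "(c + (s - 1) * \<Sum>\<^sub># Z) + \<Sum>\<^sub># Z = c + s * \<Sum>\<^sub># Z"
      using mult_eq_if[of s "\<Sum>\<^sub># Z"] s0 by simp
    also have "[c + s * \<Sum>\<^sub># Z = c] (mod s)" by (simp only: cong_def mod_mult_self2)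
    finally show ?thesis .
  qed
  have "\<Sum>\<^sub># Y = \<Sum>\<^sub># Z + p * 1 + p * (u - 1)"
    unfolding Y_def Z_def using C_sum[of 1] C_sum[of "u - 1"] by simp
  also have "\<dots> = \<Sum>\<^sub># Z + s" using u by (simp add: s algebra_simps flip: mult_Suc_right)
  finally have YZ: "[\<Sum>\<^sub># Y = \<Sum>\<^sub># Z] (mod s)" by (simp add: cong_def)
  have es: "e < s" using s0 by (simp add: e_def)
  have "add_mset e Z \<in> residue_multisets s t c" "add_mset e Y \<in> residue_multisets s t c"
    using C_range[of 0] C_range[of 1] C_range[of "u - 1"] u t es s0 e
      cong_trans[OF cong_add[OF cong_refl YZ] e]
    by (auto simp: residue_multisets_def multisets_of_size_def Y_def Z_def in_replicate_mset)
  moreover have "omega_sum s (add_mset e Z) = omega_sum s (add_mset e Y)"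
    using C_omega by (simp add: omega_sum_def Y_def Z_def)
  ultimately have "add_mset e Z = add_mset e Y"
    using inj by (auto dest: inj_onD)
  then have "count Z 0 = count Y 0" by simp
  then have "count (C 0) 0 + count (C 0) 0 = count (C 1) 0 + count (C (u - 1)) 0"
    by (simp add: Y_def Z_def)
  moreover have "0 \<in># C 0"
    using p by (auto simp: C_def intro!: image_eqI[of _ _ 0])
  moreover have "0 \<notin># C 1" "0 \<notin># C (u - 1)"
    using u by (auto simp: C_def)
  ultimately show False by (metis add_eq_0_iff_both_eq_0 count_eq_zero_iff)
qed

lemma card_omega_sums_iff:
  assumes s: "s > 1" and t: "t > 1" and st: "coprime s t"
  shows "card (omega_sum s ` residue_multisets s t c) = card (residue_multisets s t c) \<longleftrightarrow>
    prime s \<or> t < 2 * smallest_prime_divisor s"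
proof -
  let ?p = "smallest_prime_divisor s"
  have "card (omega_sum s ` residue_multisets s t c) = card (residue_multisets s t c) \<longleftrightarrow>
      inj_on (omega_sum s) (residue_multisets s t c)"
    by (metis finite_residue_multisets inj_on_iff_eq_card)
  also have "\<dots> \<longleftrightarrow> prime s \<or> t < 2 * ?p"
  proof
    assume inj: "inj_on (omega_sum s) (residue_multisets s t c)"
    show "prime s \<or> t < 2 * ?p"
    proof (rule ccontr)
      assume neg: "\<not> ?thesis"
      note p = smallest_prime_divisor[OF s]
      obtain u where u: "s = ?p * u" using p(2) by auto
      have "u \<noteq> 0" "u \<noteq> 1" using u s neg p(1) by (auto simp: mult.commute)
      \<comment> \<open>The boundary case would make \<open>?p\<close> a common divisor of
        \<open>s\<close> and \<open>t\<close>.\<close>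
      moreover have "t \<noteq> 2 * ?p"
        using st p by (metis coprime_common_divisor dvd_triv_right not_prime_unit)
      ultimately show False
        using not_inj_on_omega_sum[OF u _ _, of t c] inj neg prime_gt_1_nat[OF p(1)] by auto
    qed
  qed (use s in \<open>auto intro: inj_on_omega_sum_prime inj_on_omega_sum_small\<close>)
  finally show ?thesis .
qed

section \<open>Cores and beads\<close>

definition part :: "nat list \<Rightarrow> nat \<Rightarrow> nat" where
  "part \<pi> i = (if i < length \<pi> then \<pi> ! i else 0)"

text \<open>The beta-numbers; the rows beyond the last part contribute the beads \<open>- i\<close>.\<close>

definition bead :: "nat list \<Rightarrow> nat \<Rightarrow> int" where
  "bead \<pi> i = int (part \<pi> i) - int i"

definition beads :: "nat list \<Rightarrow> int set" where
  "beads \<pi> = range (bead \<pi>)"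

definition cell_content :: "nat \<times> nat \<Rightarrow> int" where
  "cell_content c = int (snd c) - int (fst c)"

lemma cell_content_Pair [simp]: "cell_content (i, j) = int j - int i"
  by (simp add: cell_content_def)

lemma mem_diagram_iff: "(i, j) \<in> diagram \<pi> \<longleftrightarrow> j < part \<pi> i"
  by (auto simp: diagram_def part_def)

lemma diagram_Sigma: "diagram \<pi> = Sigma {..<length \<pi>} (\<lambda>i. {..<\<pi> ! i})"
  by (auto simp: diagram_def)

lemma finite_diagram [simp]: "finite (diagram \<pi>)"
  by (simp add: diagram_Sigma)

lemma part_mono:
  assumes "is_partition \<pi>" "i \<le> i'"
  shows "part \<pi> i' \<le> part \<pi> i"
proof (rule ccontr)
  assume "\<not> ?thesis"
  then have "(i', part \<pi> i) \<in> diagram \<pi>" by (simp add: mem_diagram_iff)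
  then have "(i, part \<pi> i) \<in> diagram \<pi>" using diagram_down_closed assms by blast
  then show False by (simp add: mem_diagram_iff)
qed

lemma part_eq_0: "length \<pi> \<le> i \<Longrightarrow> part \<pi> i = 0"
  by (simp add: part_def)

lemma part_pos: "is_partition \<pi> \<Longrightarrow> i < length \<pi> \<Longrightarrow> part \<pi> i > 0"
  by (auto simp: part_def is_partition_def)

lemma bead_ge: "- int i \<le> bead \<pi> i"
  by (simp add: bead_def)

lemma bead_strict_mono:
  assumes "is_partition \<pi>" "i < i'"
  shows "bead \<pi> i' < bead \<pi> i"
  using part_mono[OF assms(1), of i i'] assms(2) by (simp add: bead_def)

lemma inj_bead: "is_partition \<pi> \<Longrightarrow> inj (bead \<pi>)"
  by (metis bead_strict_mono injI linorder_neqE_nat order_less_irrefl)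

lemma bead_eq: "length \<pi> \<le> i \<Longrightarrow> bead \<pi> i = - int i"
  by (simp add: bead_def part_eq_0)

lemma beads_low:
  assumes "x \<le> - int (length \<pi>)"
  shows "x \<in> beads \<pi>"
proof -
  have "bead \<pi> (nat (- x)) = x" using assms by (subst bead_eq) auto
  then show ?thesis unfolding beads_def by (metis rangeI)
qed

lemma beads_above:
  assumes "is_partition \<pi>" "length \<pi> \<le> N"
  shows "{x \<in> beads \<pi>. - int N < x} = bead \<pi> ` {..<N}"
proof -
  have "- int N < bead \<pi> i \<longleftrightarrow> i < N" for i
  proof (cases "i < N")
    case True
    then show ?thesis using bead_ge[of i \<pi>] by simp
  next
    case False
    then show ?thesis using assms(2) by (simp add: bead_eq)
  qed
  then show ?thesis by (auto simp: beads_def)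
qed

lemma ex_partition_part:
  assumes "\<And>i. p (Suc i) \<le> p i" and "p N = (0 :: nat)"
  shows "\<exists>\<pi>. is_partition \<pi> \<and> part \<pi> = p"
proof -
  define L where "L = (LEAST i. p i = 0)"
  have mono: "p j \<le> p i" if "i \<le> j" for i j
    using that assms(1) by (rule lift_Suc_antimono_le[rotated])
  have L: "p L = 0" unfolding L_def using assms(2) by (rule LeastI)
  have pos: "p i > 0" if "i < L" for i
    using not_less_Least[of i "\<lambda>i. p i = 0"] that by (auto simp: L_def)
  have "is_partition (map p [0..<L])"
    using mono pos by (auto simp: is_partition_def sorted_wrt_iff_nth_less)
  moreover have "part (map p [0..<L]) = p"
    using mono[of L] L by (auto simp: part_def)
  ultimately show ?thesis by blast
qed

lemma ex_partition_diagram: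
  assumes fin: "finite E"
    and down: "\<And>i j i' j'. (i, j) \<in> E \<Longrightarrow> i' \<le> i \<Longrightarrow> j' \<le> j \<Longrightarrow> (i', j') \<in> E"
  shows "\<exists>\<mu>. is_partition \<mu> \<and> diagram \<mu> = E"
proof -
  define R where "R i = {j. (i, j) \<in> E}" for i
  have finR: "finite (R i)" for i
    by (rule finite_subset[of _ "snd ` E"]) (use fin in \<open>force simp: R_def\<close>)+
  have R: "R i = {..<card (R i)}" for i
  proof -
    have "\<exists>n. R i = {..<n}"
    proof (cases "R i = {}")
      case False
      have "R i = {..<Suc (Max (R i))}"
      proof (intro equalityI subsetI)
        fix j assume "j \<in> {..<Suc (Max (R i))}"
        then have "j \<le> Max (R i)" by simp
        moreover have "(i, Max (R i)) \<in> E" using Max_in[OF finR False] by (simp add: R_def)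
        ultimately have "(i, j) \<in> E" using down[OF _ order.refl] by blast
        then show "j \<in> R i" by (simp add: R_def)
      qed (simp add: less_Suc_eq_le finR)
      then show ?thesis by blast
    qed auto
    then show ?thesis by force
  qed
  obtain N where N: "\<forall>i \<in> fst ` E. i < N"
    using fin finite_nat_set_iff_bounded by (metis finite_imageI)
  then have "R N = {}" by (force simp: R_def)
  moreover have "card (R (Suc i)) \<le> card (R i)" for i
    by (rule card_mono[OF finR]) (use down in \<open>force simp: R_def\<close>)
  ultimately obtain \<mu> where \<mu>: "is_partition \<mu>" "part \<mu> = (\<lambda>i. card (R i))"
    using ex_partition_part[of "\<lambda>i. card (R i)" N] by auto
  have "(i, j) \<in> diagram \<mu> \<longleftrightarrow> (i, j) \<in> E" for i j
    using R[of i] unfolding mem_diagram_iff \<mu>(2) by (auto simp: R_def)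
  then have "diagram \<mu> = E" by auto
  with \<mu>(1) show ?thesis by blast
qed

text \<open>The parts are read off from the elements above \<open>- N\<close> in decreasing order.
  That there are exactly \<open>N\<close> of them makes the parts nonnegative and lets the rows from
  \<open>N\<close> on be empty.\<close>

lemma ex_partition_beads:
  assumes low: "\<And>x. x \<le> - int N \<Longrightarrow> x \<in> X"
    and fin: "finite {x \<in> X. - int N < x}" and card: "card {x \<in> X. - int N < x} = N"
  shows "\<exists>\<pi>. is_partition \<pi> \<and> beads \<pi> = X"
proof -
  let ?Y = "{x \<in> X. - int N < x}"
  define zs where "zs = sorted_list_of_set ?Y"
  have len: "length zs = N" and set: "set zs = ?Y" and sorted: "sorted_wrt (<) zs"
    using fin card by (auto simp: zs_def)
  have zs_ge: "- int N + 1 + int k \<le> zs ! k" if "k < N" for k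
    using that
  proof (induction k)
    case 0
    then have "zs ! 0 \<in> ?Y" using len set nth_mem by blast
    then show ?case by simp
  next
    case (Suc k)
    then show ?case using sorted_wrt_nth_less[OF sorted, of k "Suc k"] len by simp
  qed
  define e where "e i = zs ! (N - 1 - i)" for i
  define p where "p i = (if i < N then nat (e i + int i) else 0)" for i
  have e_ge: "- int i \<le> e i" if "i < N" for i
    using zs_ge[of "N - 1 - i"] that by (simp add: e_def of_nat_diff)
  have "p (Suc i) \<le> p i" for i
  proof (cases "Suc i < N")
    case True
    then have "e (Suc i) < e i"
      unfolding e_def by (intro sorted_wrt_nth_less[OF sorted]) (auto simp: len)
    then have "nat (e (Suc i) + int (Suc i)) \<le> nat (e i + int i)" by (intro nat_mono) simp
    then show ?thesis using True by (simp add: p_def)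
  qed (simp add: p_def)
  moreover have "p N = 0" by (simp add: p_def)
  ultimately obtain \<pi> where \<pi>: "is_partition \<pi>" "part \<pi> = p"
    using ex_partition_part by blast
  have bead: "bead \<pi> i = (if i < N then e i else - int i)" for i
    using e_ge[of i] by (auto simp: bead_def \<pi> p_def)
  have eY: "e ` {..<N} = ?Y"
  proof -
    have "e ` {..<N} = (\<lambda>k. zs ! k) ` (\<lambda>i. N - 1 - i) ` {..<N}"
      by (simp add: e_def image_image)
    also have "(\<lambda>i. N - 1 - i) ` {..<N} = {..<N}"
    proof (intro equalityI subsetI)
      fix k assume "k \<in> {..<N}"
      then show "k \<in> (\<lambda>i. N - 1 - i) ` {..<N}" by (intro image_eqI[of _ _ "N - 1 - k"]) auto
    qed auto
    also have "(\<lambda>k. zs ! k) ` {..<N} = ?Y"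
      using set len by (auto simp: set_conv_nth)
    finally show ?thesis .
  qed
  have "x \<in> beads \<pi> \<longleftrightarrow> x \<in> X" for x
  proof (cases "- int N < x")
    case True
    have "x \<in> beads \<pi> \<longleftrightarrow> x \<in> e ` {..<N}"
      using True by (auto simp: beads_def bead image_iff split: if_splits)
    then show ?thesis using True eY by auto
  next
    case False
    then have "\<not> nat (- x) < N" "x \<le> 0" by linarith+
    then have "bead \<pi> (nat (- x)) = x" by (simp add: bead)
    then show ?thesis using low[of x] False by (metis beads_def not_less rangeI)
  qed
  then show ?thesis using \<pi>(1) by auto
qed

section \<open>Rim cells, diagonals and beads\<close>

lemma rim_iff:
  "is_partition \<pi> \<Longrightarrow> (i, j) \<in> rim (diagram \<pi>) \<longleftrightarrow> j < part \<pi> i \<and> part \<pi> (Suc i) \<le> Suc j"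
  by (simp add: mem_rim_diagram_iff mem_diagram_iff not_less)

text \<open>A second rim cell further down the diagonal would force the lower right neighbour of the
  first into the diagram.\<close>

lemma inj_on_content_rim:
  assumes "is_partition \<pi>"
  shows "inj_on cell_content (rim (diagram \<pi>))"
proof -
  have *: False if "(i, j) \<in> rim (diagram \<pi>)" "(i', j') \<in> rim (diagram \<pi>)"
    "int j - int i = int j' - int i'" "i < i'" for i j i' j'
  proof -
    have "part \<pi> i' \<le> part \<pi> (Suc i)" using that by (intro part_mono assms) auto
    then show False using that by (simp add: rim_iff[OF assms])
  qed
  show ?thesis
  proof (rule inj_onI, clarify)
    fix i j i' j'
    assume "(i, j) \<in> rim (diagram \<pi>)" "(i', j') \<in> rim (diagram \<pi>)"
      "cell_content (i, j) = cell_content (i', j')"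
    then show "i = i' \<and> j = j'"
      using *[of i j i' j'] *[of i' j' i j] by (cases i i' rule: linorder_cases) auto
  qed
qed

lemma adjacent_rim:
  assumes \<pi>: "is_partition \<pi>" and c: "c \<in> rim (diagram \<pi>)" "d \<in> rim (diagram \<pi>)"
    and succ: "cell_content d = cell_content c + 1"
  shows "adjacent c d"
proof -
  obtain i j i' j' where cd: "c = (i, j)" "d = (i', j')" by fastforce
  have eq: "int j' - int i' = int j - int i + 1" using succ by (simp add: cd)
  have "\<not> i < i'"
  proof
    assume "i < i'"
    then have "part \<pi> i' \<le> part \<pi> (Suc i)" by (intro part_mono \<pi>) auto
    then show False using c eq \<open>i < i'\<close> by (simp add: cd rim_iff[OF \<pi>])
  qed
  moreover have "\<not> Suc i' < i"
  proof
    assume "Suc i' < i"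
    then have "part \<pi> i \<le> part \<pi> (Suc i')" by (intro part_mono \<pi>) auto
    then show False using c eq \<open>Suc i' < i\<close> by (simp add: cd rim_iff[OF \<pi>])
  qed
  ultimately have "i' = i \<and> j' = Suc j \<or> i = Suc i' \<and> j' = j" using eq by linarith
  then show ?thesis by (auto simp: adjacent_def cd)
qed

text \<open>The lowest cell of a diagonal is on the rim; the bounds on \<open>c\<close> ensure that
  the diagonal meets the first row or column of the diagram.\<close>

lemma ex_rim_content:
  assumes \<pi>: "is_partition \<pi>" and c: "- int (length \<pi>) < c" "c < int (part \<pi> 0)"
  shows "\<exists>d \<in> rim (diagram \<pi>). cell_content d = c"
proof -
  define I where "I = fst ` {d \<in> diagram \<pi>. cell_content d = c}"
  have fin: "finite I" by (simp add: I_def)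
  have "I \<noteq> {}"
  proof (cases "c \<ge> 0")
    case True
    then have "(0, nat c) \<in> {d \<in> diagram \<pi>. cell_content d = c}"
      using c by (simp add: mem_diagram_iff)
    then show ?thesis unfolding I_def by blast
  next
    case False
    then have "(nat (- c), 0) \<in> {d \<in> diagram \<pi>. cell_content d = c}"
      using c part_pos[OF \<pi>, of "nat (- c)"] by (simp add: mem_diagram_iff)
    then show ?thesis unfolding I_def by blast
  qed
  then have "Max I \<in> I" by (rule Max_in[OF fin])
  then obtain j where j: "(Max I, j) \<in> diagram \<pi>" "cell_content (Max I, j) = c"
    unfolding I_def by (metis (mono_tags, lifting) imageE mem_Collect_eq prod.collapse)
  have "(Suc (Max I), Suc j) \<notin> diagram \<pi>"
  proof
    assume "(Suc (Max I), Suc j) \<in> diagram \<pi>"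
    then have "Suc (Max I) \<in> I"
      unfolding I_def using j(2) by (intro image_eqI[of _ _ "(Suc (Max I), Suc j)"]) (auto simp: I_def)
    then show False using Max_ge[OF fin] by (metis Suc_n_not_le_n)
  qed
  then have "(Max I, j) \<in> rim (diagram \<pi>)" using j(1) by (simp add: mem_rim_diagram_iff[OF \<pi>])
  then show ?thesis using j(2) by blast
qed

text \<open>A discrete intermediate value theorem: adjacent cells have contents differing by
  1.\<close>

lemma content_connected_interval:
  assumes "(\<lambda>x y. x \<in> H \<and> y \<in> H \<and> adjacent x y)\<^sup>*\<^sup>* c d" "c \<in> H"
    and "cell_content c \<le> v" "v \<le> cell_content d"
  shows "v \<in> cell_content ` H"
  using assms(1,4)
proof (induction rule: rtranclp_induct)
  case base
  then show ?case using assms by auto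
next
  case (step y z)
  show ?case
  proof (cases "v \<le> cell_content y")
    case False
    then have "v = cell_content z"
      using step by (auto simp: adjacent_def cell_content_def)
    then show ?thesis using step by blast
  qed (use step in blast)
qed

text \<open>Row \<open>i\<close> meets the diagonal iff \<open>c < bead \<pi> i\<close> and
  \<open>- c \<le> i\<close>; the rows with \<open>i < - c\<close> satisfy the first condition
  automatically and are subtracted.\<close>

lemma diagonal_card:
  assumes \<pi>: "is_partition \<pi>"
  shows "int (card {d \<in> diagram \<pi>. cell_content d = c}) = int (card {i. c < bead \<pi> i}) - int (nat (- c))"
    and "finite {i. c < bead \<pi> i}"
proof -
  let ?I = "{i. c < bead \<pi> i}"
  show fin: "finite ?I"
  proof (rule finite_subset)
    show "?I \<subseteq> {..<max (length \<pi>) (nat (- c))}"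
      by (auto simp: bead_eq not_less split: if_splits simp flip: not_le)
  qed simp
  have sub: "{..<nat (- c)} \<subseteq> ?I"
  proof
    fix i assume "i \<in> {..<nat (- c)}"
    then show "i \<in> ?I" using bead_ge[of i \<pi>] by auto
  qed
  have "bij_betw fst {d \<in> diagram \<pi>. cell_content d = c} (?I - {..<nat (- c)})"
  proof (rule bij_betw_byWitness[where f' = "\<lambda>i. (i, nat (int i + c))"])
    show "\<forall>d \<in> {d \<in> diagram \<pi>. cell_content d = c}. (fst d, nat (int (fst d) + c)) = d"
      by (auto simp: cell_content_def)
  qed (auto simp: mem_diagram_iff bead_def)
  then have "card {d \<in> diagram \<pi>. cell_content d = c} = card ?I - card {..<nat (- c)}"
    using bij_betw_same_card card_Diff_subset[OF _ sub] by fastforce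
  then show "int (card {d \<in> diagram \<pi>. cell_content d = c}) = int (card ?I) - int (nat (- c))"
    using card_mono[OF fin sub] by simp
qed

lemma bead_iff_diagonals:
  assumes \<pi>: "is_partition \<pi>"
  shows "of_bool (c + 1 \<in> beads \<pi>) = int (card {d \<in> diagram \<pi>. cell_content d = c})
    - int (card {d \<in> diagram \<pi>. cell_content d = c + 1}) + of_bool (c < 0)"
proof -
  let ?E = "{i. bead \<pi> i = c + 1}"
  have "{i. c < bead \<pi> i} = {i. c + 1 < bead \<pi> i} \<union> ?E" by auto
  then have "card {i. c < bead \<pi> i} = card {i. c + 1 < bead \<pi> i} + card ?E"
    using diagonal_card(2)[OF \<pi>, of c] by (subst card_Un_disjoint[symmetric]) auto
  moreover have "card ?E = of_bool (c + 1 \<in> beads \<pi>)"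
  proof (cases "c + 1 \<in> beads \<pi>")
    case True
    then obtain i where "bead \<pi> i = c + 1" by (auto simp: beads_def)
    then have "?E = {i}" using inj_bead[OF \<pi>] by (auto simp: inj_eq simp flip: \<open>bead \<pi> i = c + 1\<close>)
    then show ?thesis using True by simp
  next
    case False
    then have "?E = {}" by (metis (mono_tags, lifting) beads_def empty_Collect_eq rangeI)
    then show ?thesis using False by simp
  qed
  ultimately show ?thesis
    using diagonal_card(1)[OF \<pi>, of c] diagonal_card(1)[OF \<pi>, of "c + 1"] by auto
qed

text \<open>If \<open>x\<close> is a bead and \<open>x - t\<close> is not, the rim cells with contents from \<open>x - t\<close> to \<open>x - 1\<close> form
  a rim hook.\<close>

lemma bead_closed_if_core:
  assumes core: "is_core t \<pi>" and x: "x \<in> beads \<pi>" and t: "t > 0"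
  shows "x - int t \<in> beads \<pi>"
proof (rule ccontr)
  assume a: "x - int t \<notin> beads \<pi>"
  have \<pi>: "is_partition \<pi>" using core by (simp add: is_core_def)
  obtain k where k: "x = int (part \<pi> k) - int k" using x by (auto simp: beads_def bead_def)
  let ?R = "rim (diagram \<pi>)"
  define H where "H = {d \<in> ?R. x - int t \<le> cell_content d \<and> cell_content d < x}"
  have ex: "\<exists>d \<in> H. cell_content d = c" if "x - int t \<le> c" "c < x" for c
  proof -
    have "- int (length \<pi>) < x - int t" using a beads_low[of "x - int t" \<pi>] by linarith
    moreover have "x \<le> int (part \<pi> 0)" using part_mono[OF \<pi>, of 0 k] by (simp add: k)
    ultimately have "- int (length \<pi>) < c" "c < int (part \<pi> 0)" using that by linarith+
    then obtain d where "d \<in> ?R" "cell_content d = c" using ex_rim_content[OF \<pi>] by blast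
    then show ?thesis using that unfolding H_def by blast
  qed
  have inj: "inj_on cell_content H"
    by (rule inj_on_subset[OF inj_on_content_rim[OF \<pi>]]) (auto simp: H_def)
  have "cell_content ` H = {x - int t..<x}" using ex by (auto simp: H_def image_iff) (metis)
  then have "card H = t" using card_image[OF inj] by simp
  let ?r = "\<lambda>c d. c \<in> H \<and> d \<in> H \<and> adjacent c d"
  have reach: "?r\<^sup>*\<^sup>* c d" if "c \<in> H" "d \<in> H" "cell_content d = cell_content c + int n" for c d n
    using that(2,3)
  proof (induction n arbitrary: d)
    case 0
    then have "c = d" using inj that(1) by (auto dest: inj_onD)
    then show ?case by simp
  next
    case (Suc n)
    have "x - int t \<le> cell_content c + int n" "cell_content c + int n < x"
      using Suc.prems that(1) by (auto simp: H_def)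
    then obtain d' where d': "d' \<in> H" "cell_content d' = cell_content c + int n"
      using ex by blast
    then have "adjacent d' d"
      using Suc.prems by (intro adjacent_rim[OF \<pi>]) (auto simp: H_def)
    then show ?case
      using Suc.IH[OF d'] d'(1) Suc.prems(1) by (auto intro: rtranclp.rtrancl_into_rtrancl)
  qed
  have "symp ?r" by (auto simp: symp_def adjacent_def)
  then have sym: "symp ?r\<^sup>*\<^sup>*" by (rule symp_rtranclp)
  have conn: "connected_cells H"
    unfolding connected_cells_def
  proof (intro ballI)
    fix c d assume cd: "c \<in> H" "d \<in> H"
    show "?r\<^sup>*\<^sup>* c d"
    proof (cases "cell_content c \<le> cell_content d")
      case True
      then show ?thesis using reach[OF cd, of "nat (cell_content d - cell_content c)"] by simp
    next
      case False
      then show ?thesis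
        using reach[OF cd(2,1), of "nat (cell_content c - cell_content d)"] sympD[OF sym] by simp
    qed
  qed
  \<comment> \<open>A cell outside \<open>H\<close> to the lower right of a cell of \<open>H\<close>
    is itself on the rim, hence in the same row or column. In the same row its content is at least
    \<open>x\<close>, contradicting the bead \<open>x\<close> of row \<open>k\<close>; in the same
    column it is below \<open>x - int t\<close>.\<close>
  have down: "(i', j') \<in> diagram \<pi> - H"
    if ij: "(i, j) \<in> diagram \<pi> - H" and le: "i' \<le> i" "j' \<le> j" for i j i' j'
  proof (rule ccontr)
    have D: "(i', j') \<in> diagram \<pi>" using ij le diagram_down_closed[OF \<pi>] by blast
    assume "\<not> ?thesis"
    with D have H: "(i', j') \<in> H" by blast
    then have rim': "part \<pi> (Suc i') \<le> Suc j'" "x - int t \<le> int j' - int i'" "int j' - int i' < x"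
      by (auto simp: H_def rim_iff[OF \<pi>])
    have jp: "j < part \<pi> i" using ij by (simp add: mem_diagram_iff)
    have "part \<pi> (Suc i) \<le> part \<pi> (Suc i')" using le by (intro part_mono \<pi>) simp
    then have "(i, j) \<in> ?R" using rim' jp le by (simp add: rim_iff[OF \<pi>])
    then have out: "int j - int i < x - int t \<or> x \<le> int j - int i"
      using ij by (auto simp: H_def)
    have "\<not> (Suc i' \<le> i \<and> Suc j' \<le> j)"
      using rim' jp part_mono[OF \<pi>, of "Suc i'" i] by linarith
    then consider "i' = i" | "j' = j" "i' < i" using le by linarith
    then show False
    proof cases
      case 1
      then have xj: "x \<le> int j - int i" using out rim' le by linarith
      consider "k \<le> i" | "Suc i \<le> k" by linarith
      then show False
      proof cases
        case 1
        then show False using part_mono[OF \<pi> 1] jp xj k by linarith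
      next
        case 2
        then show False
          using part_mono[OF \<pi> 2] rim' k unfolding \<open>i' = i\<close> by linarith
      qed
    next
      case 2
      then have lt: "int j - int i < x - int t" using out rim' by linarith
      \<comment> \<open>Rows \<open>Suc i'\<close> to \<open>i\<close> all have length
        \<open>Suc j\<close>, so their beads are consecutive integers; \<open>r\<close> is the row
        whose bead is \<open>x - int t\<close>.\<close>
      define r where "r = nat (int j - (x - int t) + 1)"
      have r: "int r = int j - (x - int t) + 1" "Suc i' \<le> r" "r \<le> i"
        using rim' 2 lt by (auto simp: r_def)
      have "part \<pi> r = Suc j"
        using part_mono[OF \<pi> r(2)] part_mono[OF \<pi> r(3)] rim' jp 2 by linarith
      then have "bead \<pi> r = x - int t" using r(1) by (simp add: bead_def)
      then show False using a by (metis beads_def rangeI)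
    qed
  qed
  have "\<exists>\<mu>. is_partition \<mu> \<and> diagram \<mu> = diagram \<pi> - H"
    by (rule ex_partition_diagram) (simp, rule down)
  then obtain \<mu> where "is_partition \<mu>" "diagram \<mu> = diagram \<pi> - H" by blast
  moreover have "H \<noteq> {}" using \<open>card H = t\<close> t by auto
  moreover have "H \<subseteq> ?R" by (auto simp: H_def)
  ultimately have "rim_hook \<pi> H" using conn by (auto simp: rim_hook_def)
  then show False using core \<open>card H = t\<close> by (auto simp: is_core_def)
qed

text \<open>Removing a rim hook with contents from \<open>a\<close> to \<open>b\<close> moves the bead \<open>b + 1\<close> to \<open>a\<close>, as the
  lengths of the diagonals show.\<close>

lemma core_if_bead_closed:
  assumes \<pi>: "is_partition \<pi>" and closed: "\<And>x. x \<in> beads \<pi> \<Longrightarrow> x - int t \<in> beads \<pi>"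
  shows "is_core t \<pi>"
  unfolding is_core_def
proof (intro conjI notI \<pi>)
  assume "\<exists>H. rim_hook \<pi> H \<and> card H = t"
  then obtain H \<mu> where H: "H \<noteq> {}" "H \<subseteq> rim (diagram \<pi>)" "connected_cells H" "card H = t"
    and \<mu>: "is_partition \<mu>" "diagram \<pi> - H = diagram \<mu>"
    by (auto simp: rim_hook_def)
  have HD: "H \<subseteq> diagram \<pi>" using H(2) by (auto simp: rim_def)
  then have finH: "finite H" by (rule finite_subset) simp
  have inj: "inj_on cell_content H"
    by (rule inj_on_subset[OF inj_on_content_rim[OF \<pi>] H(2)])
  define a b where "a = Min (cell_content ` H)" and "b = Max (cell_content ` H)"
  have ab: "a \<in> cell_content ` H" "b \<in> cell_content ` H"
    using finH H(1) by (auto simp: a_def b_def intro!: Min_in Max_in)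
  have range: "a \<le> v" "v \<le> b" if "v \<in> cell_content ` H" for v
    using finH that by (auto simp: a_def b_def)
  have img: "cell_content ` H = {a..b}"
  proof (intro equalityI subsetI)
    fix v assume v: "v \<in> {a..b}"
    obtain c d where "c \<in> H" "d \<in> H" "cell_content c = a" "cell_content d = b" using ab by auto
    moreover have "(\<lambda>x y. x \<in> H \<and> y \<in> H \<and> adjacent x y)\<^sup>*\<^sup>* c d"
      using H(3) calculation by (simp add: connected_cells_def)
    ultimately show "v \<in> cell_content ` H" using content_connected_interval v by auto
  qed (use range in auto)
  have t: "int t = b - a + 1"
    using card_image[OF inj] range(1)[OF ab(2)] by (simp add: img H(4))
  have diag: "int (card {d \<in> diagram \<mu>. cell_content d = c})
      = int (card {d \<in> diagram \<pi>. cell_content d = c}) - of_bool (c \<in> {a..b})" for c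
  proof -
    have "{d \<in> diagram \<mu>. cell_content d = c} = {d \<in> diagram \<pi>. cell_content d = c} - {d \<in> H. cell_content d = c}"
      using \<mu>(2) by auto
    moreover have "card {d \<in> H. cell_content d = c} = of_bool (c \<in> {a..b})"
    proof (cases "c \<in> {a..b}")
      case True
      then obtain h where "h \<in> H" "cell_content h = c" using img by (metis imageE)
      then have "{d \<in> H. cell_content d = c} = {h}" using inj by (auto dest: inj_onD)
      then show ?thesis using True by simp
    next
      case False
      then have "{d \<in> H. cell_content d = c} = {}" using img by blast
      then show ?thesis using False by (simp only: card.empty of_bool_eq)
    qed
    moreover have "{d \<in> H. cell_content d = c} \<subseteq> {d \<in> diagram \<pi>. cell_content d = c}"
      using HD by auto
    ultimately show ?thesis
      using card_Diff_subset[of "{d \<in> H. cell_content d = c}" "{d \<in> diagram \<pi>. cell_content d = c}"]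
        card_mono[of "{d \<in> diagram \<pi>. cell_content d = c}" "{d \<in> H. cell_content d = c}"] finH
      by simp
  qed
  have diff: "of_bool (c + 1 \<in> beads \<pi>) - of_bool (c + 1 \<in> beads \<mu>)
      = (of_bool (c \<in> {a..b}) - of_bool (c + 1 \<in> {a..b}) :: int)" for c
    unfolding bead_iff_diagonals[OF \<pi>] bead_iff_diagonals[OF \<mu>(1)] diag by simp
  have "a \<le> b" using range(1)[OF ab(2)] .
  \<comment> \<open>At \<open>c = b\<close> the difference is 1 and at \<open>c = a - 1\<close> it
    is -1, which forces both memberships.\<close>
  then have "b + 1 \<in> beads \<pi>" "a \<notin> beads \<pi>"
    using diff[of b] diff[of "a - 1"] by (auto simp: of_bool_def split: if_splits)
  moreover have "b + 1 - int t = a" using t by simp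
  ultimately show False using closed by metis
qed

section \<open>Values of the GBG-rank on cores\<close>

text \<open>The regularised sum of \<open>f x - f (x - t)\<close> over a set closed under subtracting \<open>t\<close> only
  sees the topmost element in each residue class modulo \<open>t\<close>.\<close>

definition tops :: "nat \<Rightarrow> int set \<Rightarrow> int set" where
  "tops t X = {x \<in> X. x + int t \<notin> X}"

context
  fixes X :: "int set" and t N :: nat
  assumes closed: "\<And>x. x \<in> X \<Longrightarrow> x - int t \<in> X"
    and low: "\<And>x. x \<le> int t - int N \<Longrightarrow> x \<in> X"
    and fin: "finite {x \<in> X. - int N < x}"
begin

lemma tops_subset: "tops t X \<subseteq> {x \<in> X. - int N < x}"
proof
  fix x assume x: "x \<in> tops t X"
  then have "\<not> x + int t \<le> int t - int N" using low by (auto simp: tops_def)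
  with x show "x \<in> {x \<in> X. - int N < x}" by (simp add: tops_def)
qed

lemma finite_tops: "finite (tops t X)"
  using tops_subset fin by (rule finite_subset)

text \<open>Shifting the truncated set down by \<open>t\<close> loses the tops and gains the
  \<open>t\<close> positions \<open>?W\<close> just below the cut; everything else cancels.\<close>

lemma sum_minus_shift:
  fixes f :: "int \<Rightarrow> 'a :: ab_group_add"
  shows "(\<Sum>x | x \<in> X \<and> - int N < x. f x - f (x - int t))
    = (\<Sum>x\<in>tops t X. f x) - (\<Sum>i<t. f (- int N - int i))"
proof -
  let ?Y = "{x \<in> X. - int N < x}" and ?W = "{- int N - int t<..- int N}"
  let ?K = "{x \<in> ?Y. x + int t \<in> X}"
  have finK: "finite ?K" by (rule finite_subset[OF _ fin]) auto
  have Y: "?Y = tops t X \<union> ?K" using tops_subset by (auto simp: tops_def)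
  have "(\<Sum>x\<in>?Y. f x) = (\<Sum>x\<in>tops t X. f x) + (\<Sum>x\<in>?K. f x)"
    by (subst Y, rule sum.union_disjoint[OF finite_tops finK]) (auto simp: tops_def)
  moreover have "(\<Sum>x\<in>?Y. f (x - int t)) = (\<Sum>x\<in>?K. f x) + (\<Sum>x\<in>?W. f x)"
  proof -
    have img: "(\<lambda>x. x - int t) ` ?Y = ?K \<union> ?W"
    proof (intro equalityI subsetI)
      fix x assume "x \<in> ?K \<union> ?W"
      then have "x + int t \<in> ?Y" using low[of "x + int t"] by auto
      then show "x \<in> (\<lambda>x. x - int t) ` ?Y" by (rule rev_image_eqI) simp
    qed (use closed in auto)
    have "(\<Sum>x\<in>?Y. f (x - int t)) = (\<Sum>x\<in>(\<lambda>x. x - int t) ` ?Y. f x)"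
      by (subst sum.reindex) (auto simp: inj_on_def)
    also have "\<dots> = (\<Sum>x\<in>?K. f x) + (\<Sum>x\<in>?W. f x)"
      unfolding img by (rule sum.union_disjoint[OF finK]) auto
    finally show ?thesis .
  qed
  moreover have "(\<Sum>x\<in>?W. f x) = (\<Sum>i<t. f (- int N - int i))"
    by (rule sum.reindex_bij_witness[of _ "\<lambda>i. - int N - int i" "\<lambda>x. nat (- int N - x)"]) auto
  ultimately show ?thesis by (simp add: sum_subtractf)
qed

lemma card_tops: "card (tops t X) = t"
  using sum_minus_shift[of "\<lambda>_. 1 :: int"] by simp

text \<open>For the identity function every difference is \<open>t\<close>, so the sum of the tops
  measures the excess of elements above \<open>- N\<close> over \<open>N\<close>.\<close>

lemma sum_tops:
  "(\<Sum>x\<in>tops t X. x) = int t * (int (card {x \<in> X. - int N < x}) - int N) - (\<Sum>i<t. int i)"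
  using sum_minus_shift[of "\<lambda>x. x"] by (simp add: sum_subtractf algebra_simps)

lemma sum_power_tops:
  fixes z :: complex
  assumes "z \<noteq> 0"
  shows "(1 - z powi (- int t)) * (\<Sum>x | x \<in> X \<and> - int N < x. z powi x)
    = (\<Sum>x\<in>tops t X. z powi x) - (\<Sum>i<t. z powi (- int N - int i))"
  using sum_minus_shift[of "\<lambda>x. z powi x"] assms
  by (simp add: sum_distrib_left algebra_simps power_int_diff power_int_minus divide_inverse)

end

section \<open>The GBG-rank in terms of beads\<close>

lemma omega_powi_mod:
  assumes s: "s > 0"
  shows "omega s powi x = omega s ^ nat (x mod int s)"
proof -
  have "omega s powi x = omega s powi (int s * (x div int s) + x mod int s)" by simp
  also have "\<dots> = (omega s powi int s) powi (x div int s) * omega s powi (x mod int s)"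
    by (simp only: power_int_add power_int_mult omega_neq_0 simp_thms)
  also have "omega s powi int s = 1" using s by simp
  also have "omega s powi (x mod int s) = omega s ^ nat (x mod int s)"
    using s by (simp add: power_int_def)
  finally show ?thesis by simp
qed

lemma GBG_rank_eq:
  assumes s: "s > 0"
  shows "GBG_rank \<pi> s = (\<Sum>d\<in>diagram \<pi>. omega s powi (cell_content d))"
proof -
  let ?g = "\<lambda>d. nat (cell_content d mod int s)"
  have g: "?g d = k \<longleftrightarrow> [cell_content d = int k] (mod int s)" if "k < s" for d k
    using that s by (auto simp: cong_def)
  have pw: "omega s powi (cell_content d) = omega s ^ ?g d" for d
    by (rule omega_powi_mod[OF s])
  have "GBG_rank \<pi> s = (\<Sum>k\<in>{0..s - 1}. \<Sum>d | d \<in> diagram \<pi> \<and> ?g d = k. omega s powi (cell_content d))"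
    unfolding GBG_rank_def
  proof (intro sum.cong refl)
    fix k assume "k \<in> {0..s - 1}"
    then have k: "k < s" using s by auto
    have "{d. d \<in> diagram \<pi> \<and> ?g d = k}
        = {(i, j). (i, j) \<in> diagram \<pi> \<and> [int j - int i = int k] (mod int s)}"
      using g[OF k] by auto
    then have "residue_count \<pi> s k = card {d. d \<in> diagram \<pi> \<and> ?g d = k}"
      by (simp add: residue_count_def)
    then show "of_nat (residue_count \<pi> s k) * omega s ^ k
        = (\<Sum>d | d \<in> diagram \<pi> \<and> ?g d = k. omega s powi (cell_content d))"
      by (simp add: pw)
  qed
  also have "\<dots> = (\<Sum>d\<in>diagram \<pi>. omega s powi (cell_content d))"
    by (rule sum.group) (use s in \<open>auto simp: nat_less_iff less_Suc_eq_le[symmetric]\<close>)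
  finally show ?thesis .
qed

text \<open>Each row is a geometric progression, telescoping from \<open>- i\<close> to its
  bead.\<close>

lemma GBG_rank_beads:
  assumes s: "s > 0" and N: "length \<pi> \<le> N"
  shows "(omega s - 1) * GBG_rank \<pi> s
    = (\<Sum>i<N. omega s powi bead \<pi> i) - (\<Sum>i<N. omega s powi (- int i))"
proof -
  let ?w = "omega s"
  have row: "(?w - 1) * (\<Sum>j<n. ?w powi (int j - int i)) = ?w powi (int n - int i) - ?w powi (- int i)"
    for n i
  proof (induction n)
    case (Suc n)
    have "?w powi (int (Suc n) - int i) = ?w powi (int n - int i) * ?w"
      using power_int_add_1[of ?w "int n - int i"] by (simp add: algebra_simps)
    with Suc show ?case by (simp add: algebra_simps)
  qed simp
  have "diagram \<pi> = Sigma {..<N} (\<lambda>i. {..<part \<pi> i})"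
    using N by (auto simp: mem_diagram_iff part_def split: if_splits)
  then have rank: "GBG_rank \<pi> s = (\<Sum>i<N. \<Sum>j<part \<pi> i. ?w powi (int j - int i))"
    by (simp add: GBG_rank_eq[OF s] sum.Sigma split_def cell_content_def)
  have "(?w - 1) * GBG_rank \<pi> s = (\<Sum>i<N. (?w - 1) * (\<Sum>j<part \<pi> i. ?w powi (int j - int i)))"
    unfolding rank by (rule sum_distrib_left)
  then show ?thesis by (simp only: row sum_subtractf bead_def)
qed

lemma GBG_rank_core:
  assumes s: "s > 0" and t: "t > 0" and core: "is_core t \<pi>"
  shows "(1 - omega s powi (- int t)) * (omega s - 1) * GBG_rank \<pi> s
      = (\<Sum>x\<in>tops t (beads \<pi>). omega s powi x) - (\<Sum>i<t. omega s powi (- int i))" (is ?rank)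
    and "finite (tops t (beads \<pi>))" "card (tops t (beads \<pi>)) = t"
    and "(\<Sum>x\<in>tops t (beads \<pi>). x) = - (\<Sum>i<t. int i)"
proof -
  let ?w = "omega s"
  have \<pi>: "is_partition \<pi>" using core by (simp add: is_core_def)
  define N where "N = length \<pi> + t"
  have closed: "x - int t \<in> beads \<pi>" if "x \<in> beads \<pi>" for x
    using bead_closed_if_core[OF core that t] .
  have low: "x \<in> beads \<pi>" if "x \<le> int t - int N" for x
    using that by (intro beads_low) (simp add: N_def)
  have Y: "{x \<in> beads \<pi>. - int N < x} = bead \<pi> ` {..<N}"
    by (rule beads_above[OF \<pi>]) (simp add: N_def)
  then have fin: "finite {x \<in> beads \<pi>. - int N < x}" by simp
  have cardY: "card {x \<in> beads \<pi>. - int N < x} = N"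
    using inj_bead[OF \<pi>] by (simp add: Y card_image inj_on_subset)
  note ctxt = closed low fin
  show "finite (tops t (beads \<pi>))" using ctxt by (rule finite_tops)
  show "card (tops t (beads \<pi>)) = t" using ctxt by (rule card_tops)
  show "(\<Sum>x\<in>tops t (beads \<pi>). x) = - (\<Sum>i<t. int i)"
    using sum_tops[OF ctxt] by (simp add: cardY)
  have X: "(1 - ?w powi (- int t)) * (\<Sum>i<N. ?w powi bead \<pi> i)
      = (\<Sum>x\<in>tops t (beads \<pi>). ?w powi x) - (\<Sum>i<t. ?w powi (- int N - int i))"
    using sum_power_tops[OF ctxt, of ?w] inj_bead[OF \<pi>]
    by (simp add: Y sum.reindex inj_on_subset)
  \<comment> \<open>\<open>{..0}\<close> is the bead set of the empty partition. Applying the shift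
    formula to it as well cancels the terms that depend on the cut.\<close>
  have Y0: "{x \<in> {..0}. - int N < x} = (\<lambda>i. - int i) ` {..<N}"
    by (auto intro!: image_eqI[of _ _ "nat (- _)"])
  have T0: "tops t {..0} = (\<lambda>i. - int i) ` {..<t}"
    by (auto simp: tops_def intro!: image_eqI[of _ _ "nat (- _)"])
  have X0: "(1 - ?w powi (- int t)) * (\<Sum>i<N. ?w powi (- int i))
      = (\<Sum>i<t. ?w powi (- int i)) - (\<Sum>i<t. ?w powi (- int N - int i))"
  proof -
    have "(1 - ?w powi (- int t)) * (\<Sum>x | x \<in> {..0} \<and> - int N < x. ?w powi x)
      = (\<Sum>x\<in>tops t {..0}. ?w powi x) - (\<Sum>i<t. ?w powi (- int N - int i))"
    proof (rule sum_power_tops)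
      show "finite {x \<in> {..0}. - int N < x}" unfolding Y0 by simp
    qed (auto simp: N_def)
    then show ?thesis unfolding Y0 T0 by (simp add: sum.reindex inj_on_def)
  qed
  have "(1 - ?w powi (- int t)) * (?w - 1) * GBG_rank \<pi> s = (1 - ?w powi (- int t)) *
      ((\<Sum>i<N. ?w powi bead \<pi> i) - (\<Sum>i<N. ?w powi (- int i)))"
    using GBG_rank_beads[OF s, of \<pi> N] by (simp add: N_def mult.assoc)
  then show ?rank by (simp only: right_diff_distrib[of _ "sum _ _"] X X0) simp
qed

lemma omega_sum_eq_powi:
  assumes s: "s > 0" and "finite T"
  shows "omega_sum s (image_mset (\<lambda>x. nat (x mod int s)) (mset_set T)) = (\<Sum>x\<in>T. omega s powi x)"
  by (simp add: omega_sum_def image_mset.compositionality o_def sum_unfold_sum_mset omega_powi_mod[OF s])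

section \<open>From cores to residue multisets and back\<close>

lemma core_residue_multiset:
  assumes s: "s > 0" and t: "t > 0" and core: "is_core t \<pi>"
    and c: "[int c = - (\<Sum>i<t. int i)] (mod int s)"
  shows "image_mset (\<lambda>x. nat (x mod int s)) (mset_set (tops t (beads \<pi>))) \<in> residue_multisets s t c"
proof -
  let ?T = "tops t (beads \<pi>)"
  note T = GBG_rank_core(2-4)[OF s t core]
  have "[(\<Sum>x\<in>?T. x mod int s) = (\<Sum>x\<in>?T. x)] (mod int s)"
    by (intro cong_sum) (simp add: cong_def)
  also have "[(\<Sum>x\<in>?T. x) = int c] (mod int s)" using c unfolding T(3) by (rule cong_sym)
  also have "(\<Sum>x\<in>?T. x mod int s) = int (\<Sum>x\<in>?T. nat (x mod int s))"
    using s by simp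
  finally have "[(\<Sum>x\<in>?T. nat (x mod int s)) = c] (mod s)" by (simp only: cong_int_iff)
  then show ?thesis
    using s T by (auto simp: residue_multisets_def multisets_of_size_def sum_unfold_sum_mset
        nat_less_iff)
qed

text \<open>The Chinese remainder theorem gives each \<open>m i\<close>. The error \<open>D\<close>
  in the total is divisible by both \<open>s\<close> and \<open>t\<close>, so subtracting it from
  \<open>m 0\<close> changes no residue.\<close>

lemma ex_charges:
  fixes a :: "nat \<Rightarrow> int"
  assumes st: "coprime (int s) (int t)" and t: "t > 0"
    and sum: "[(\<Sum>i<t. a i) = - (\<Sum>i<t. int i)] (mod int s)"
  shows "\<exists>m. (\<forall>i<t. [m i = a i] (mod int s) \<and> [m i = - int i] (mod int t))
    \<and> (\<Sum>i<t. m i) = - (\<Sum>i<t. int i)"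
proof -
  obtain u where u: "[int s * u = 1] (mod int t)"
    using cong_solve_coprime_int[OF st] by blast
  define m where "m i = a i + int s * u * (- int i - a i)" for i
  have ms: "[m i = a i] (mod int s)" for i
    by (simp add: m_def cong_iff_dvd_diff)
  have mt: "[m i = - int i] (mod int t)" for i
  proof -
    have "[m i = a i + 1 * (- int i - a i)] (mod int t)"
      unfolding m_def by (intro cong_add cong_mult u cong_refl)
    then show ?thesis by simp
  qed
  define D where "D = (\<Sum>i<t. m i) + (\<Sum>i<t. int i)"
  have "[(\<Sum>i<t. m i) = (\<Sum>i<t. a i)] (mod int s)" by (intro cong_sum ms)
  then have "[(\<Sum>i<t. m i) = - (\<Sum>i<t. int i)] (mod int s)" using sum by (rule cong_trans)
  then have Ds: "int s dvd D" by (simp add: D_def cong_iff_dvd_diff)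
  have "[(\<Sum>i<t. m i) = (\<Sum>i<t. - int i)] (mod int t)" by (intro cong_sum mt)
  then have Dt: "int t dvd D" by (simp add: D_def cong_iff_dvd_diff sum_negf)
  define m' where "m' i = m i - (if i = 0 then D else 0)" for i
  have "(\<Sum>i<t. m' i) = (\<Sum>i<t. m i) - D"
    using t by (simp add: m'_def sum_subtractf)
  moreover have "[m' i = m i] (mod int s)" "[m' i = m i] (mod int t)" for i
    using Ds Dt by (auto simp: m'_def cong_iff_dvd_diff)
  ultimately show ?thesis
    using cong_trans[OF _ ms] cong_trans[OF _ mt] by (intro exI[of _ m']) (simp add: D_def)
qed

lemma ex_core_tops:
  assumes t: "t > 0" and m: "\<And>i. i < t \<Longrightarrow> [m i = - int i] (mod int t)"
    and sum: "(\<Sum>i<t. m i) = - (\<Sum>i<t. int i)"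
  shows "\<exists>\<pi>. is_core t \<pi> \<and> tops t (beads \<pi>) = m ` {..<t}" and "inj_on m {..<t}"
proof -
  \<comment> \<open>The index of the residue class of \<open>x\<close>: the \<open>i < t\<close>
    with \<open>x\<close> congruent to \<open>- i\<close>.\<close>
  define r where "r x = nat ((- x) mod int t)" for x
  have r_less: "r x < t" for x using t by (simp add: r_def nat_less_iff)
  have r_m: "r (m i) = i" if "i < t" for i
  proof -
    have "[- m i = int i] (mod int t)" using m[OF that] cong_minus_minus_iff by fastforce
    then show ?thesis using that by (simp add: r_def cong_def)
  qed
  then show inj: "inj_on m {..<t}" by (metis inj_onI lessThan_iff)
  have r_minus: "r (x - int t) = r x" "r (x + int t) = r x" for x
    by (simp_all add: r_def mod_diff_eq flip: mod_diff_right_eq)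
  define X where "X = {x. x \<le> m (r x)}"
  define B where "B = (\<Sum>i<t. nat \<bar>m i\<bar>)"
  have B: "\<bar>m i\<bar> \<le> int B" if "i < t" for i
  proof -
    have "nat \<bar>m i\<bar> \<le> B" unfolding B_def by (rule member_le_sum) (use that in auto)
    then show ?thesis by linarith
  qed
  define N where "N = B + t"
  have closed: "x - int t \<in> X" if "x \<in> X" for x
    using that by (simp add: X_def r_minus)
  have low: "x \<in> X" if "x \<le> int t - int N" for x
    using that B[OF r_less[of x]] by (simp add: X_def N_def)
  have fin: "finite {x \<in> X. - int N < x}"
  proof (rule finite_subset)
    show "{x \<in> X. - int N < x} \<subseteq> {- int N..int B}"
    proof
      fix x assume "x \<in> {x \<in> X. - int N < x}"
      then show "x \<in> {- int N..int B}" using B[OF r_less[of x]] by (auto simp: X_def)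
    qed
  qed simp
  note ctxt = closed low fin
  have tops: "tops t X = m ` {..<t}"
  proof (intro equalityI subsetI)
    fix x assume "x \<in> tops t X"
    then have x: "x \<le> m (r x)" "m (r x) < x + int t" by (auto simp: tops_def X_def r_minus)
    have "[m (r x) = - int (r x)] (mod int t)" by (rule m[OF r_less])
    also have "int (r x) = (- x) mod int t" using t by (simp add: r_def)
    also have "[- ((- x) mod int t) = x] (mod int t)"
      by (simp add: cong_def mod_minus_eq)
    finally have "int t dvd m (r x) - x" by (simp add: cong_iff_dvd_diff)
    then have "m (r x) = x" using x zdvd_imp_le[of "int t" "m (r x) - x"] by linarith
    then show "x \<in> m ` {..<t}" using r_less by (metis imageI lessThan_iff)
  next
    fix x assume "x \<in> m ` {..<t}"
    then show "x \<in> tops t X" using t by (auto simp: tops_def X_def r_minus r_m)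
  qed
  have "(\<Sum>x\<in>tops t X. x) = - (\<Sum>i<t. int i)"
    unfolding tops using sum by (simp add: sum.reindex[OF inj])
  \<comment> \<open>The prescribed sum of the tops is what makes \<open>X\<close> the bead set of a
    partition.\<close>
  then have "card {x \<in> X. - int N < x} = N"
    using sum_tops[OF ctxt] t by simp
  then have "\<exists>\<pi>. is_partition \<pi> \<and> beads \<pi> = X"
    using low fin by (intro ex_partition_beads[of N]) auto
  then obtain \<pi> where \<pi>: "is_partition \<pi>" "beads \<pi> = X" by blast
  then have "is_core t \<pi>" using closed by (intro core_if_bead_closed) auto
  then show "\<exists>\<pi>. is_core t \<pi> \<and> tops t (beads \<pi>) = m ` {..<t}" using \<pi> tops by auto
qed

lemma residue_multiset_from_core:
  assumes s: "s > 0" and t: "t > 0" and st: "coprime s t" and M: "M \<in> residue_multisets s t c"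
    and c: "[int c = - (\<Sum>i<t. int i)] (mod int s)"
  shows "\<exists>\<pi>. is_core t \<pi> \<and> (\<Sum>x\<in>tops t (beads \<pi>). omega s powi x) = omega_sum s M"
proof -
  obtain as where as: "mset as = M" using ex_mset by blast
  have len: "length as = t" using residue_multisetsD(2)[OF M] as by auto
  have sum_as: "(\<Sum>i<t. as ! i) = \<Sum>\<^sub># M"
    using as len by (metis atLeast0LessThan sum_list_sum_nth sum_mset_sum_list)
  have "[int (\<Sum>i<t. as ! i) = int c] (mod int s)"
    using residue_multisetsD(3)[OF M] by (simp only: sum_as cong_int_iff)
  then have "[(\<Sum>i<t. int (as ! i)) = - (\<Sum>i<t. int i)] (mod int s)"
    using c by (metis cong_trans of_nat_sum)
  then obtain m where m: "\<And>i. i < t \<Longrightarrow> [m i = int (as ! i)] (mod int s)"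
      "\<And>i. i < t \<Longrightarrow> [m i = - int i] (mod int t)" "(\<Sum>i<t. m i) = - (\<Sum>i<t. int i)"
    using ex_charges[of s t "\<lambda>i. int (as ! i)"] st t by auto
  obtain \<pi> where \<pi>: "is_core t \<pi>" "tops t (beads \<pi>) = m ` {..<t}"
    using ex_core_tops(1)[OF t m(2,3)] by blast
  have "(\<Sum>x\<in>m ` {..<t}. omega s powi x) = (\<Sum>i<t. omega s powi m i)"
    by (simp add: sum.reindex[OF ex_core_tops(2)[OF t m(2,3)]])
  also have "\<dots> = (\<Sum>i<t. omega s ^ (as ! i))"
  proof (intro sum.cong refl)
    fix i assume "i \<in> {..<t}"
    then have "m i mod int s = int (as ! i) mod int s" using m(1) by (simp add: cong_def)
    then show "omega s powi m i = omega s ^ (as ! i)"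
      using s omega_powi_mod[OF s, of "int (as ! i)"] by (simp add: omega_powi_mod[OF s, of "m i"])
  qed
  also have "\<dots> = omega_sum s M"
  proof -
    have "(\<Sum>i<t. omega s ^ (as ! i)) = (\<Sum>a\<leftarrow>as. omega s ^ a)"
      using len by (simp add: sum_list_sum_nth atLeast0LessThan)
    also have "\<dots> = omega_sum s M"
      unfolding omega_sum_def as[symmetric] by (metis mset_map sum_mset_sum_list)
    finally show ?thesis .
  qed
  finally show ?thesis using \<pi> by auto
qed

text \<open>The affine map from ranks to sums over top beads is injective: its slope is nonzero
  because \<open>s\<close> divides neither 1 nor \<open>t\<close>.\<close>

lemma nu_eq_card_omega_sums:
  assumes s: "s > 1" and t: "t > 0" and st: "coprime s t"
    and c: "[int c = - (\<Sum>i<t. int i)] (mod int s)"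
  shows "nu s t = card (omega_sum s ` residue_multisets s t c)"
proof -
  have s0: "s > 0" using s by simp
  let ?C = "\<Sum>i<t. omega s powi (- int i)"
  let ?K = "(1 - omega s powi (- int t)) * (omega s - 1)"
  have "\<not> s dvd t" using st s by (metis coprime_common_divisor_nat dvd_refl less_irrefl nat_dvd_1_iff_1)
  then have "omega s ^ t \<noteq> 1" "omega s ^ 1 \<noteq> 1"
    using s by (simp_all only: omega_power_eq_1_iff[OF s0]) auto
  then have K: "?K \<noteq> 0" by (simp add: power_int_minus)
  have img: "(\<lambda>g. ?K * g + ?C) ` {GBG_rank \<pi> s | \<pi>. is_core t \<pi>} = omega_sum s ` residue_multisets s t c"
  proof (intro equalityI subsetI)
    fix v assume "v \<in> (\<lambda>g. ?K * g + ?C) ` {GBG_rank \<pi> s | \<pi>. is_core t \<pi>}"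
    then obtain \<pi> where \<pi>: "is_core t \<pi>" "v = ?K * GBG_rank \<pi> s + ?C" by auto
    then have "v = (\<Sum>x\<in>tops t (beads \<pi>). omega s powi x)"
      using GBG_rank_core(1)[OF s0 t \<pi>(1)] by simp
    then show "v \<in> omega_sum s ` residue_multisets s t c"
      using core_residue_multiset[OF s0 t \<pi>(1) c] omega_sum_eq_powi[OF s0 GBG_rank_core(2)[OF s0 t \<pi>(1)]]
      by (metis imageI)
  next
    fix v assume "v \<in> omega_sum s ` residue_multisets s t c"
    then obtain M where M: "M \<in> residue_multisets s t c" "v = omega_sum s M" by auto
    then obtain \<pi> where \<pi>: "is_core t \<pi>" "(\<Sum>x\<in>tops t (beads \<pi>). omega s powi x) = v"
      using residue_multiset_from_core[OF s0 t st M(1) c] by auto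
    then have "v = ?K * GBG_rank \<pi> s + ?C"
      using GBG_rank_core(1)[OF s0 t \<pi>(1)] by simp
    then show "v \<in> (\<lambda>g. ?K * g + ?C) ` {GBG_rank \<pi> s | \<pi>. is_core t \<pi>}"
      using \<pi>(1) by blast
  qed
  have "inj_on (\<lambda>g. ?K * g + ?C) {GBG_rank \<pi> s | \<pi>. is_core t \<pi>}"
    using K by (intro inj_onI) (simp only: add_right_cancel mult_cancel_left simp_thms)
  from card_image[OF this] show ?thesis unfolding nu_def img by (rule sym)
qed

theorem theorem1p3:
  fixes s t :: nat
  assumes "s > 1" and "t > 1" and "gcd s t = 1"
  shows "real (nu s t) = 1 / real (t + s) * real ((t + s) choose t) \<longleftrightarrow>
         prime s \<or> (\<not> prime s \<and> t < 2 * smallest_prime_divisor s)"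
proof -
  have st: "coprime s t" using assms(3) coprime_iff_gcd_eq_1 by blast
  \<comment> \<open>The residue of the sum of the top beads, which is the same for all
    cores.\<close>
  define c where "c = nat ((- (\<Sum>i<t. int i)) mod int s)"
  have c: "[int c = - (\<Sum>i<t. int i)] (mod int s)"
    using assms(1) by (simp add: c_def cong_def)
  let ?R = "residue_multisets s t c"
  \<comment> \<open>The absorption identity turns the number of residue multisets into the
    Catalan-type number.\<close>
  have "s * ((t + s) choose t) = (t + s) * ((s + t - 1) choose t)"
    using assms(1) binomial_absorb_comp[of "t + s" t] by (simp add: add.commute)
  also have "\<dots> = s * ((t + s) * card ?R)"
    using card_residue_multisets[OF _ st, of c] assms(1) by (simp add: mult_ac)
  finally have "(t + s) choose t = (t + s) * card ?R" using assms(1) by simp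
  then have "1 / real (t + s) * real ((t + s) choose t) = real (card ?R)"
    using assms(1) by (simp del: of_nat_add)
  moreover have "nu s t = card (omega_sum s ` ?R)"
    using nu_eq_card_omega_sums[OF assms(1) _ st c] assms(2) by simp
  ultimately show ?thesis
    using card_omega_sums_iff[OF assms(1,2) st, of c] by auto
qed

end
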